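(* Let $n\ge 1$, and let $\varepsilon_0^d(n)$ and $C(\varepsilon,n)$ denote the sharp constants in the integral John--Nirenberg inequality for the dyadic BMO on $\mathbb{R}^n$ (as defined in the context). Then $$ \varepsilon_0^d(n)=\frac{2^{n/2}}{2^n-1}\,n\,\log 2, $$ and, for every $0\le\varepsilon<\varepsilon_0^d(n)$, $$ C(\varepsilon,n)=\frac{2^n-1}{2^n\, e^{2^{-n/2}\varepsilon}-e^{2^{n/2}\varepsilon}}. $$
   Context: $\mathcal{D}$ is the collection of all open dyadic cubes in $\mathbb{R}^n$ (the standard dyadic lattice, determined by the root cube $(0,1)^n$). For a locally integrable real function $\varphi$ and a cube $J$, $\langle\varphi\rangle_J=\frac1{|J|}\int_J\varphi$ (Lebesgue measure). The dyadic BMO norm is $$\|\varphi\|_{\mathrm{BMO}^d(\mathbb{R}^n)}=\sup_{J\in\mathcal{D}}\big(\langle|\varphi-\langle\varphi\rangle_J|^2\rangle_J\big)^{1/2},$$ $\mathrm{BMO}^d(\mathbb{R}^n)$ is the set of $\varphi\in L^1_{loc}(\mathbb{R}^n)$ for which it is finite, and $\mathrm{BMO}^d_\varepsilon(\mathbb{R}^n)$ is the set of $\varphi\in \mathrm{BMO}^d(\mathbb{R}^n)$ with norm at most $\varepsilon$. The integral John--Nirenberg inequality states that there is a number $\varepsilon_0>0$ such that for every $0\le\varepsilon<\varepsilon_0$ there is a finite constant $C>0$ (depending on $\varepsilon$ and $n$) such that for all $\varphi\in\mathrm{BMO}^d_\varepsilon(\mathbb{R}^n)$ and all $Q\in\mathcal{D}$,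 $$\langle e^\varphi\rangle_Q\le C\,e^{\langle\varphi\rangle_Q}.$$ $\varepsilon_0^d(n)$ denotes the largest possible $\varepsilon_0$ in this statement, and, for $0\le\varepsilon<\varepsilon_0^d(n)$, $C(\varepsilon,n)$ denotes the smallest possible $C$ for that $\varepsilon$. *)

theory Defs
  imports "HOL-Analysis.Analysis"
begin

definition dyadic_cubes :: "(real ^ 'n) set set" where
  "dyadic_cubes =
     {box (\<chi> i. of_int (m $ i) * 2 powi k) (\<chi> i. (of_int (m $ i) + 1) * 2 powi k)
      | (k :: int) (m :: int ^ 'n). True}"

definition locally_integrable :: "(real ^ 'n \<Rightarrow> real) \<Rightarrow> bool" where
  "locally_integrable \<phi> \<longleftrightarrow> (\<forall>K. compact K \<longrightarrow> set_integrable lebesgue K \<phi>)"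

definition avg :: "(real ^ 'n) set \<Rightarrow> (real ^ 'n \<Rightarrow> real) \<Rightarrow> real" where
  "avg J \<phi> = set_lebesgue_integral lebesgue J \<phi> / measure lebesgue J"

text \<open>Averages of nonnegative functions take values in \<^typ>\<open>ennreal\<close>: the Bochner integral of a
  non-integrable function is 0, so \<^term>\<open>avg\<close> would make the average of a non-integrable square or
  exponential 0 instead of infinite.\<close>

definition nn_avg :: "(real ^ 'n) set \<Rightarrow> (real ^ 'n \<Rightarrow> ennreal) \<Rightarrow> ennreal" where
  "nn_avg J f = set_nn_integral lebesgue J f / emeasure lebesgue J"

definition ennreal_sqrt :: "ennreal \<Rightarrow> ennreal" where
  "ennreal_sqrt x = (if x = \<infinity> then \<infinity> else ennreal (sqrt (enn2real x)))"

definition bmo_norm :: "(real ^ 'n \<Rightarrow> real) \<Rightarrow> ennreal" where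
  "bmo_norm \<phi> =
     (SUP J\<in>dyadic_cubes. ennreal_sqrt (nn_avg J (\<lambda>x. ennreal (\<bar>\<phi> x - avg J \<phi>\<bar>\<^sup>2))))"

definition BMO :: "(real ^ 'n \<Rightarrow> real) set" where
  "BMO = {\<phi>. locally_integrable \<phi> \<and> bmo_norm \<phi> < \<infinity>}"

definition BMO_ball :: "real \<Rightarrow> (real ^ 'n \<Rightarrow> real) set" where
  "BMO_ball \<epsilon> = {\<phi> \<in> BMO. bmo_norm \<phi> \<le> ennreal \<epsilon>}"

text \<open>The type argument \<open>TYPE('n)\<close> below carries the dimension \<open>n = CARD('n)\<close>.\<close>

definition JN_constant :: "'n::finite itself \<Rightarrow> real \<Rightarrow> real \<Rightarrow> bool" where
  "JN_constant _ \<epsilon> C \<longleftrightarrow> 0 < C \<and>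
     (\<forall>\<phi> :: real ^ 'n \<Rightarrow> real. \<phi> \<in> BMO_ball \<epsilon> \<longrightarrow>
       (\<forall>Q\<in>dyadic_cubes. nn_avg Q (\<lambda>x. ennreal (exp (\<phi> x))) \<le> ennreal (C * exp (avg Q \<phi>))))"

definition JN_range :: "'n::finite itself \<Rightarrow> real \<Rightarrow> bool" where
  "JN_range n \<epsilon>0 \<longleftrightarrow> 0 < \<epsilon>0 \<and> (\<forall>\<epsilon>. 0 \<le> \<epsilon> \<and> \<epsilon> < \<epsilon>0 \<longrightarrow> (\<exists>C. JN_constant n \<epsilon> C))"

text \<open>\<^const>\<open>Greatest\<close> and \<^const>\<open>Least\<close> are unspecified if there is no greatest or least element, so
  statements about the two sharp constants should also assert that they are attained and extremal.\<close>

definition sharp_eps0 :: "'n::finite itself \<Rightarrow> real" where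
  "sharp_eps0 n = (GREATEST \<epsilon>0. JN_range n \<epsilon>0)"

definition sharp_C :: "real \<Rightarrow> 'n::finite itself \<Rightarrow> real" where
  "sharp_C \<epsilon> n = (LEAST C. JN_constant n \<epsilon> C)"

end

theory Submission
  imports Defs
begin

text \<open>Put \<open>N = 2\<^sup>n\<close> and \<open>\<alpha> = 1/N\<close>. The upper bound is a Bellman function argument with the candidate
  \<open>B(x, V) = exp x * psi (\<delta>\<^sup>2 - V) / psi (\<delta>\<^sup>2)\<close>, where \<open>x\<close> is the mean and \<open>V\<close> the variance of \<open>\<phi>\<close> on a
  cube; this is the Bellman function of the continuous BMO with a larger radius \<open>\<delta>\<close>, chosen such that
  \<open>B(0, \<epsilon>\<^sup>2)\<close> is the claimed constant. It is not concave along segments that leave the strip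
  \<open>V \<le> \<delta>\<^sup>2\<close>, but the inequality between the value on a cube and the average over its \<open>N\<close> children
  survives: splitting off one child at a time reduces it to two points with weights at least \<open>\<alpha>\<close>,
  and the configuration can be moved, without raising a negative gap, either to one where the tangent
  plane of \<open>B\<close> is a majorant or to the extremal one, where the gap vanishes by the choice of \<open>\<delta>\<close>.

  The lower bound comes from a function whose levels on \<open>(0,1)\<^sup>n\<close> form an arithmetic progression along
  the shells between consecutive cubes at the corner 0: on one child it is a rescaled copy of itself
  plus a constant, on the others it is constant, and its variance is exactly \<open>\<epsilon>\<^sup>2\<close>.\<close>

section \<open>Sign of a function from sign changes of its derivative\<close>

text \<open>Both bounds come from one fixed-point equation. With
  \<open>D = \<epsilon> / sqrt \<alpha>\<close>, the exponential average \<open>X\<close> of the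
  extremal function over the unit cube, where its mean is 0, satisfies \<open>X = (1 - \<alpha>) *
  exp (- (\<alpha> * D)) + \<alpha> * exp ((1 - \<alpha>) * D) * X\<close>: constant children plus
  one shifted copy. Iterating gives a geometric series; its ratio reaches 1 at the critical
  \<epsilon>, and its sum is the claimed constant. The vanishing of \<open>gap\<close> at the
  extremal configuration is the same equation for
  \<open>X = psi (W\<^sup>2) / psi (W\<^sup>2 + \<epsilon>\<^sup>2)\<close>. A second obstacle is
  that \<open>exp \<circ> \<phi>\<close> is not known to be integrable, so an induction over
  generations cannot end with it. The induction is run for the minorants
  \<open>exp s * (1 + \<phi> - s)\<close>, with \<open>s\<close> constant on the cubes of the last
  generation; these are integrable because \<phi> is, and on a last cube with mean \<open>m\<close>
  it only remains to see that \<open>exp s * (1 + m - s) \<le> exp m\<close>.\<close>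

lemma descent_point:
  fixes f f' :: "real \<Rightarrow> real"
  assumes "continuous_on {a..b} f" and "a \<le> b" and "0 \<le> f a" and "f b < 0"
    and "\<And>x. a < x \<Longrightarrow> x < b \<Longrightarrow> (f has_real_derivative f' x) (at x)"
  shows "\<exists>x. a < x \<and> x < b \<and> f x < 0 \<and> f' x < 0"
proof -
  \<comment> \<open>The largest point of \<open>S\<close> is the last place where \<open>f\<close>
    is nonnegative; the mean value theorem from there to \<open>b\<close> yields a negative slope at
    a point where \<open>f\<close> is negative.\<close>
  define S where "S = {a..b} \<inter> f -` {0..}"
  have "closed S" unfolding S_def
    by (rule continuous_closed_preimage) (use assms in auto)
  moreover have "bounded S" unfolding S_def by (rule bounded_subset[of "{a..b}"]) auto
  ultimately have "compact S" by (simp add: compact_eq_bounded_closed)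
  moreover have "a \<in> S" using assms by (auto simp: S_def)
  ultimately obtain s where s: "s \<in> S" "\<And>t. t \<in> S \<Longrightarrow> t \<le> s"
    using compact_attains_sup[of S] by auto
  have neg: "f t < 0" if "s < t" "t \<le> b" for t
  proof (rule ccontr)
    assume "\<not> f t < 0"
    then have "t \<in> S" using s(1) that by (auto simp: S_def)
    then show False using s(2)[of t] that by simp
  qed
  have "s < b" using s(1) assms(4) by (auto simp: S_def le_less)
  have "\<exists>l z. s < z \<and> z < b \<and> DERIV f z :> l \<and> f b - f s = (b - s) * l"
  proof (rule MVT)
    show "continuous_on {s..b} f"
      by (rule continuous_on_subset[OF assms(1)]) (use s in \<open>auto simp: S_def\<close>)
    show "f differentiable at x" if "s < x" "x < b" for x
      using assms(5)[of x] s that by (auto simp: S_def real_differentiable_def)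
  qed (fact \<open>s < b\<close>)
  then obtain l z where z: "s < z" "z < b" "DERIV f z :> l" "f b - f s = (b - s) * l"
    by blast
  have "a < z" using z s by (auto simp: S_def)
  then have "l = f' z" using assms(5)[of z] z DERIV_unique by blast
  moreover have "(b - s) * l < 0"
    using z(4) assms(4) s(1) by (auto simp: S_def)
  then have "l < 0" using \<open>s < b\<close> by (simp add: mult_less_0_iff)
  ultimately show ?thesis using neg[of z] z \<open>a < z\<close> by auto
qed

lemma ascent_point:
  fixes f f' :: "real \<Rightarrow> real"
  assumes "continuous_on {a..b} f" and "a \<le> b" and "f a < 0" and "0 \<le> f b"
    and "\<And>x. a < x \<Longrightarrow> x < b \<Longrightarrow> (f has_real_derivative f' x) (at x)"
  shows "\<exists>x. a < x \<and> x < b \<and> f x < 0 \<and> 0 < f' x"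
proof -
  have "\<exists>x. - b < x \<and> x < - a \<and> f (- x) < 0 \<and> - f' (- x) < 0"
  proof (rule descent_point)
    show "continuous_on {- b..- a} (\<lambda>x. f (- x))"
      by (rule continuous_on_compose2[OF assms(1)]) (auto intro!: continuous_intros)
    show "((\<lambda>x. f (- x)) has_real_derivative - f' (- x)) (at x)" if "- b < x" "x < - a" for x
      using DERIV_mirror[of f "f' (- x)" x] assms(5)[of "- x"] that by auto
  qed (use assms in auto)
  then obtain x where "- b < x" "x < - a" "f (- x) < 0" "- f' (- x) < 0" by blast
  then show ?thesis by (intro exI[of _ "- x"]) auto
qed

text \<open>A negative value inside forces \<open>f\<close> to be negative and falling at some
  \<open>s\<close>, and rising at a later \<open>t\<close>. The sign condition is asked only from
  points where \<open>f\<close> is already negative, since a negative gap itself carries information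
  about the configuration.\<close>

lemma quasiconcave_nonneg:
  fixes f f' :: "real \<Rightarrow> real"
  assumes cont: "continuous_on {a..b} f" and ends: "0 \<le> f a" "0 \<le> f b"
    and deriv: "\<And>x. a < x \<Longrightarrow> x < b \<Longrightarrow> (f has_real_derivative f' x) (at x)"
    and sign: "\<And>s t. a < s \<Longrightarrow> s < t \<Longrightarrow> t < b \<Longrightarrow> f s < 0 \<Longrightarrow> f' s < 0 \<Longrightarrow> f' t \<le> 0"
    and x: "x \<in> {a..b}"
  shows "0 \<le> f x"
proof (rule ccontr)
  assume "\<not> 0 \<le> f x"
  then have neg: "f x < 0" by simp
  obtain s where s: "a < s" "s < x" "f s < 0" "f' s < 0"
    using descent_point[of a x f f'] neg ends x deriv
      continuous_on_subset[OF cont, of "{a..x}"] by auto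
  obtain t where t: "x < t" "t < b" "f t < 0" "0 < f' t"
    using ascent_point[of x b f f'] neg ends x deriv
      continuous_on_subset[OF cont, of "{x..b}"] by auto
  show False using sign[of s t] s t by auto
qed

lemma exp_ge_quadratic:
  assumes "x \<le> (0::real)"
  shows "exp x \<le> 1 + x + x\<^sup>2 / 2"
proof -
  have "(\<lambda>x. 1 + x + x\<^sup>2 / 2 - exp x) 0 \<le> (\<lambda>x. 1 + x + x\<^sup>2 / 2 - exp x) x"
  proof (rule DERIV_nonpos_imp_nonincreasing[OF assms])
    fix y :: real
    have "((\<lambda>x. 1 + x + x\<^sup>2 / 2 - exp x) has_real_derivative 1 + y - exp y) (at y)"
      by (auto intro!: derivative_eq_intros)
    moreover have "1 + y - exp y \<le> 0" using exp_ge_add_one_self[of y] by linarith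
    ultimately show "\<exists>l. ((\<lambda>x. 1 + x + x\<^sup>2 / 2 - exp x) has_real_derivative l) (at y) \<and> l \<le> 0"
      by blast
  qed
  then show ?thesis by simp
qed

lemma one_minus_mult_exp_le: "(1 - x) * exp x \<le> (1::real)"
proof -
  have "(1 - x) * exp x \<le> exp (- x) * exp x"
    using exp_ge_add_one_self[of "- x"] by (intro mult_right_mono) auto
  then show ?thesis by (simp flip: exp_add)
qed

text \<open>This is \<open>tanh (x / 2) \<le> x / 2\<close> with denominators cleared.\<close>

lemma exp_pade:
  assumes "0 \<le> (x::real)"
  shows "0 \<le> (x / 2 - 1) * exp x + 1 + x / 2"
proof -
  have "(\<lambda>x. (x / 2 - 1) * exp x + 1 + x / 2) 0 \<le> (\<lambda>x. (x / 2 - 1) * exp x + 1 + x / 2) x"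
  proof (rule DERIV_nonneg_imp_nondecreasing[OF assms])
    fix y :: real
    have "((\<lambda>x. (x / 2 - 1) * exp x + 1 + x / 2) has_real_derivative
        (1 - (1 - y) * exp y) / 2) (at y)"
      by (auto intro!: derivative_eq_intros simp: algebra_simps)
    moreover have "(1 - (1 - y) * exp y) / 2 \<ge> 0" using one_minus_mult_exp_le[of y] by simp
    ultimately show "\<exists>l. ((\<lambda>x. (x / 2 - 1) * exp x + 1 + x / 2) has_real_derivative l) (at y) \<and> 0 \<le> l"
      by blast
  qed
  then show ?thesis by simp
qed

section \<open>The Bellman candidate\<close>

text \<open>For \<open>v = \<delta>\<^sup>2 - V\<close>, the root \<open>sqrt v\<close> is the
  horizontal distance from a point of the strip to the tangency point, on its right, of a tangent to
  the upper boundary in the plane of mean and second moment. Along this tangent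
  \<open>exp x * psi v\<close> is linear.\<close>

definition psi :: "real \<Rightarrow> real" where
  "psi v = (1 - sqrt v) * exp (sqrt v)"

lemma psi_power2: "0 \<le> w \<Longrightarrow> psi (w\<^sup>2) = (1 - w) * exp w"
  by (simp add: psi_def)

lemma continuous_on_psi [continuous_intros]:
  "continuous_on S f \<Longrightarrow> continuous_on S (\<lambda>x. psi (f x))"
  unfolding psi_def by (intro continuous_intros)

lemma has_derivative_psi:
  assumes "0 < v"
  shows "(psi has_real_derivative - exp (sqrt v) / 2) (at v)"
  unfolding psi_def[abs_def] using assms
  by (auto intro!: derivative_eq_intros simp: field_simps)

lemma psi_antimono:
  assumes "0 \<le> u" "u \<le> v"
  shows "psi v \<le> psi u"
proof (cases "u = v")
  case False
  have "\<exists>l z. u < z \<and> z < v \<and> DERIV psi z :> l \<and> psi v - psi u = (v - u) * l"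
  proof (rule MVT)
    show "continuous_on {u..v} psi" by (intro continuous_intros)
    show "psi differentiable at x" if "u < x" for x
      using has_derivative_psi[of x] that assms by (auto simp: real_differentiable_def)
  qed (use assms False in auto)
  then obtain l z where z: "u < z" "DERIV psi z :> l" "psi v - psi u = (v - u) * l" by blast
  then have "l = - exp (sqrt z) / 2"
    using DERIV_unique has_derivative_psi[of z] assms by force
  then have "(v - u) * l \<le> 0" using assms by (simp add: mult_le_0_iff)
  then show ?thesis using z by simp
qed simp

lemma psi_nonneg: "v \<le> 1 \<Longrightarrow> 0 \<le> psi v"
  by (simp add: psi_def)

lemma psi_pos: "v < 1 \<Longrightarrow> 0 < psi v"
  by (simp add: psi_def)

text \<open>The right-hand side is the tangent plane of \<open>exp h * psi v\<close>, as a function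
  of mean and second moment, at mean 0 and \<open>v = c\<^sup>2\<close>. For
  \<open>c \<ge> 0\<close>, the first alternative says that the point is not above the tangent line
  through that base point, the second that its tangency point \<open>h + w\<close> is not to the
  right of \<open>c\<close>.\<close>

lemma tangent_majorant:
  fixes c h w :: real
  assumes "0 \<le> w" and "(h - c)\<^sup>2 \<le> w\<^sup>2 \<or> h + w \<le> c"
  shows "exp h * psi (w\<^sup>2) \<le> exp c * (1 + h - c + ((h - c)\<^sup>2 - w\<^sup>2) / 2)"
proof -
  \<comment> \<open>The displacement between the two tangency points; after division by
    \<open>exp c\<close> the claim involves only \<open>p\<close> and \<open>w\<close>.\<close>
  define p where "p = h - c + w"
  have "exp p * (1 - w) \<le> 1 + p - w + p * (p - 2 * w) / 2"
  proof (cases "p \<le> 0")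
    case True
    have "0 \<le> w * (exp p - 1 - p)"
      using assms(1) exp_ge_add_one_self[of p] by (intro mult_nonneg_nonneg) linarith+
    with exp_ge_quadratic[OF True] show ?thesis by (simp add: field_simps power2_eq_square)
  next
    case False
    then have "\<bar>h - c\<bar> \<le> w" using assms by (auto simp: p_def abs_le_square_iff[symmetric])
    then have "p \<le> 2 * w" by (simp add: p_def)
    then have "p / 2 * (exp p - 1 - p) \<le> w * (exp p - 1 - p)"
      using exp_ge_add_one_self[of p] by (intro mult_right_mono) linarith+
    with exp_pade[of p] False show ?thesis by (simp add: field_simps power2_eq_square)
  qed
  then have "exp c * (exp p * (1 - w)) \<le> exp c * (1 + p - w + p * (p - 2 * w) / 2)"
    by simp
  moreover have "exp c * (exp p * (1 - w)) = exp h * psi (w\<^sup>2)"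
    using assms(1) by (simp add: psi_power2 p_def flip: exp_add)
  moreover have "1 + p - w + p * (p - 2 * w) / 2 = 1 + h - c + ((h - c)\<^sup>2 - w\<^sup>2) / 2"
    by (simp add: p_def algebra_simps power2_eq_square)
  ultimately show ?thesis by simp
qed

text \<open>In \<open>gap t a y c x\<close> the two points have weights \<open>1 - t\<close> and \<open>t\<close> and means at distance \<open>x\<close>; the
  arguments \<open>a\<close>, \<open>y\<close>, \<open>c\<close> are the values \<open>\<delta>\<^sup>2 - V\<close> at the lower point, the upper point and their
  average, and the exponentials are normalized by the mean of the average.\<close>

definition gap :: "real \<Rightarrow> real \<Rightarrow> real \<Rightarrow> real \<Rightarrow> real \<Rightarrow> real" where
  "gap t a y c x = psi c - (1 - t) * exp (- (t * x)) * psi a - t * exp ((1 - t) * x) * psi y"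

lemma gap_nonneg_if_tangent:
  fixes t a y c x :: real
  assumes t: "0 \<le> t" "t \<le> 1" and x: "0 \<le> x" and nonneg: "0 \<le> a" "0 \<le> y" "0 \<le> c"
    and c: "c = (1 - t) * a + t * y - t * (1 - t) * x\<^sup>2"
    and good: "((1 - t) * x - sqrt c)\<^sup>2 \<le> y \<or> (1 - t) * x + sqrt y \<le> sqrt c"
  shows "0 \<le> gap t a y c x"
proof -
  let ?c = "sqrt c"
  have Y: "exp ((1 - t) * x) * psi y \<le> exp ?c * (1 + (1 - t) * x - ?c + (((1 - t) * x - ?c)\<^sup>2 - y) / 2)"
    using tangent_majorant[of "sqrt y" "(1 - t) * x" ?c] good nonneg by simp
  \<comment> \<open>The lower point, lying left of the average, always satisfies one alternative;
    hence only the upper point carries a hypothesis.\<close>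
  have "(- (t * x) - ?c)\<^sup>2 \<le> (sqrt a)\<^sup>2 \<or> - (t * x) + sqrt a \<le> ?c"
  proof (rule disjCI)
    assume "\<not> - (t * x) + sqrt a \<le> ?c"
    moreover have "0 \<le> t * x" "0 \<le> ?c" using t x nonneg by auto
    ultimately have "\<bar>- (t * x) - ?c\<bar> \<le> \<bar>sqrt a\<bar>" by linarith
    then show "(- (t * x) - ?c)\<^sup>2 \<le> (sqrt a)\<^sup>2" by (simp add: abs_le_square_iff)
  qed
  then have Z: "exp (- (t * x)) * psi a \<le> exp ?c * (1 - t * x - ?c + ((- (t * x) - ?c)\<^sup>2 - a) / 2)"
    using tangent_majorant[of "sqrt a" "- (t * x)" ?c] nonneg by simp
  have "(1 - t) * (exp (- (t * x)) * psi a) + t * (exp ((1 - t) * x) * psi y) \<le>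
     (1 - t) * (exp ?c * (1 - t * x - ?c + ((- (t * x) - ?c)\<^sup>2 - a) / 2)) +
     t * (exp ?c * (1 + (1 - t) * x - ?c + (((1 - t) * x - ?c)\<^sup>2 - y) / 2))"
    by (intro add_mono mult_left_mono Y Z) (use t in auto)
  also have "\<dots> = exp ?c * ((1 - t) * (1 - t * x - ?c + ((- (t * x) - ?c)\<^sup>2 - a) / 2) +
      t * (1 + (1 - t) * x - ?c + (((1 - t) * x - ?c)\<^sup>2 - y) / 2))"
    by (simp add: algebra_simps)
  \<comment> \<open>The plane is affine in mean and second moment, and the relation for
    \<open>c\<close> is the balance of second moments, so the weighted values add up to the value at
    the average.\<close>
  also have "(1 - t) * (1 - t * x - ?c + ((- (t * x) - ?c)\<^sup>2 - a) / 2) +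
      t * (1 + (1 - t) * x - ?c + (((1 - t) * x - ?c)\<^sup>2 - y) / 2)
      = 1 - ?c + (?c\<^sup>2 - c) / 2"
    using arg_cong[OF c, of "\<lambda>v. v / 2"] by (simp add: field_simps power2_eq_square)
  also have "exp ?c * (1 - ?c + (?c\<^sup>2 - c) / 2) = psi c"
    using nonneg by (simp add: psi_def)
  finally show ?thesis by (simp add: gap_def)
qed

section \<open>Deformations of a two-point configuration\<close>

text \<open>The expression is concave in \<open>p\<close> for \<open>W \<le> 1\<close> and vanishes
  at 0, so once negative it stays so. It is the factor that decides the sign of the derivative in
  two of the deformations.\<close>

lemma tilt_sign:
  assumes "0 < p" "p \<le> r" "W \<le> 1" and neg: "1 + p - W - exp p * (1 - W) < (0::real)"
  shows "1 + r - W - exp r * (1 - W) \<le> 0"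
proof -
  define l where "l = p / r"
  have l: "0 < l" "l \<le> 1" "p = l * r" using assms by (auto simp: l_def)
  have "exp ((1 - l) *\<^sub>R 0 + l *\<^sub>R r) \<le> (1 - l) * exp 0 + l * exp r"
    by (rule convex_onD[OF exp_convex]) (use l in auto)
  then have "exp p \<le> 1 - l + l * exp r" by (simp add: l)
  then have "exp p * (1 - W) \<le> (1 - l + l * exp r) * (1 - W)"
    using assms by (intro mult_right_mono) auto
  then have "l * (1 + r - W - exp r * (1 - W)) < 0"
    using neg l by (simp add: algebra_simps)
  then show ?thesis using l by (simp add: mult_less_0_iff)
qed

lemma gap_nonneg_if_tangent_at_0:
  assumes "0 \<le> t" "t \<le> 1" "0 \<le> a" "0 \<le> y" "0 \<le> c" and "c = (1 - t) * a + t * y"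
  shows "0 \<le> gap t a y c 0"
proof (rule gap_nonneg_if_tangent)
  show "((1 - t) * 0 - sqrt c)\<^sup>2 \<le> y \<or> (1 - t) * 0 + sqrt y \<le> sqrt c"
    using assms by auto
qed (use assms in auto)

text \<open>Contrapositive of the tangent-plane bound: a negative gap locates the upper point beyond
  the tangent line through the average, with its own tangency point further to the right.\<close>

lemma gap_neg_imp:
  assumes "0 \<le> t" "t \<le> 1" "0 \<le> x" "0 \<le> a" "0 \<le> y" "0 \<le> c"
    and "c = (1 - t) * a + t * y - t * (1 - t) * x\<^sup>2" and "gap t a y c x < 0"
  shows "sqrt c < (1 - t) * x + sqrt y" "y < ((1 - t) * x - sqrt c)\<^sup>2"
  using gap_nonneg_if_tangent[of t x a y c] assms by (auto simp: not_le[symmetric])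

text \<open>Normalizing by the mean of the lower point instead frees the term with
  \<open>psi a\<close> from \<open>x\<close>; deformations that fix \<open>a\<close> are
  differentiated in this form.\<close>

lemma exp_mult_gap:
  "exp (t * x) * gap t a y c x = exp (t * x) * psi c - (1 - t) * psi a - t * exp x * psi y"
  by (simp add: gap_def algebra_simps flip: exp_add mult_exp_exp)

text \<open>Lower point and average are held fixed, and \<open>y s\<close> follows from the balance
  of second moments. Wherever the gap is negative, the rescaled gap has a nonnegative derivative, so
  a nonnegative start cannot lead to a negative value.\<close>

lemma gap_slide_upper:
  fixes t a c :: real
  defines "y \<equiv> \<lambda>s. (c - (1 - t) * a) / t + (1 - t) * s\<^sup>2"
  assumes t: "0 < t" "t < 1" and nonneg: "0 \<le> a" "0 \<le> c" and x: "0 \<le> u" "u \<le> x"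
    and yu: "0 \<le> y u" and start: "0 \<le> gap t a (y u) c u"
  shows "0 \<le> gap t a (y x) c x"
proof (rule ccontr)
  define G where "G = (\<lambda>s. exp (t * s) * psi c - (1 - t) * psi a - t * exp s * psi (y s))"
  define G' where "G' = (\<lambda>s. t * exp (t * s) * psi c
      - t * exp s * (psi (y s) - (1 - t) * s * exp (sqrt (y s))))"
  have G: "G s = exp (t * s) * gap t a (y s) c s" for s
    by (simp add: exp_mult_gap G_def)
  assume "\<not> 0 \<le> gap t a (y x) c x"
  then have "G x < 0" by (simp add: G mult_less_0_iff)
  moreover have ypos: "0 < y s" if "u < s" for s
  proof -
    have "u\<^sup>2 < s\<^sup>2" using that x by (intro power_strict_mono) auto
    then have "y u < y s" using t by (simp add: y_def)
    then show ?thesis using yu by simp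
  qed
  moreover have "(G has_real_derivative G' s) (at s)" if "u < s" for s
  proof -
    have "(y has_real_derivative 2 * (1 - t) * s) (at s)"
      unfolding y_def by (auto intro!: derivative_eq_intros)
    then have "((\<lambda>s. psi (y s)) has_real_derivative - exp (sqrt (y s)) / 2 * (2 * (1 - t) * s)) (at s)"
      by (rule DERIV_chain2[OF has_derivative_psi, rotated]) (use ypos that in auto)
    then show ?thesis
      unfolding G_def G'_def by (auto intro!: derivative_eq_intros simp: algebra_simps)
  qed
  moreover have "continuous_on {u..x} G" unfolding G_def y_def
    by (intro continuous_intros) (use t in auto)
  moreover have "0 \<le> G u" using start by (simp add: G)
  ultimately obtain s where s: "u < s" "G s < 0" "G' s < 0"
    using descent_point[of u x G G'] x by auto
  \<comment> \<open>The distance between the tangency points of the upper point and the average; a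
    negative gap makes it positive.\<close>
  define p where "p = (1 - t) * s + sqrt (y s) - sqrt c"
  have "gap t a (y s) c s < 0" using s by (simp add: G mult_less_0_iff)
  moreover have "c = (1 - t) * a + t * y s - t * (1 - t) * s\<^sup>2"
    using t by (simp add: y_def field_simps)
  ultimately have p: "0 < p"
    using gap_neg_imp(1)[of t s a "y s" c] t x s(1) less_imp_le[OF ypos[OF s(1)]] nonneg
    by (simp add: p_def)
  have e: "exp (t * s) * exp (sqrt c) * exp p = exp s * exp (sqrt (y s))"
    by (simp add: p_def algebra_simps flip: exp_add)
  have "G' s = t * (exp (t * s) * exp (sqrt c) * (1 - sqrt c)
      - exp s * exp (sqrt (y s)) * (1 - p - sqrt c))"
    unfolding G'_def psi_def p_def by (simp add: algebra_simps)
  then have "G' s = t * exp (t * s + sqrt c) * ((1 - sqrt c) - exp p * (1 - p - sqrt c))"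
    unfolding e[symmetric] exp_add by (simp add: algebra_simps)
  moreover have "exp p * (1 - p - sqrt c) \<le> 1 - sqrt c"
  proof -
    have "(1 - p) * exp p \<le> 1" by (rule one_minus_mult_exp_le)
    moreover have "1 * sqrt c \<le> exp p * sqrt c" using p nonneg by (intro mult_right_mono) auto
    ultimately show ?thesis by (simp add: algebra_simps)
  qed
  ultimately have "0 \<le> G' s" using t by simp
  then show False using s by simp
qed

text \<open>The upper point keeps its value \<open>W\<^sup>2\<close> while the average moves, from
  coinciding means at \<open>s = 0\<close> to the same value \<open>W\<^sup>2\<close> at
  \<open>s = b\<close>. In the region of negative gap the derivative cannot turn from negative to
  positive, so the two ends decide.\<close>

lemma gap_slide_mid:
  fixes t a W b :: real
  defines "c \<equiv> \<lambda>s. (1 - t) * a + t * W\<^sup>2 - t * (1 - t) * s\<^sup>2"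
  assumes t: "0 < t" "t < 1" and nonneg: "0 \<le> a" and W: "0 \<le> W" "W \<le> 1"
    and x: "0 \<le> x" "x \<le> b" and cb: "c b = W\<^sup>2" and fin: "0 \<le> gap t a (W\<^sup>2) (c b) b"
  shows "0 \<le> gap t a (W\<^sup>2) (c x) x"
proof -
  define G where "G = (\<lambda>s. exp (t * s) * psi (c s) - (1 - t) * psi a - t * exp s * psi (W\<^sup>2))"
  define p where "p = (\<lambda>s. (1 - t) * s + W - sqrt (c s))"
  define G' where "G' = (\<lambda>s. t * exp (t * s + sqrt (c s)) * (1 + p s - W - exp (p s) * (1 - W)))"
  have G: "G s = exp (t * s) * gap t a (W\<^sup>2) (c s) s" for s
    by (simp add: exp_mult_gap G_def)
  have c_anti: "c s \<le> c r" if "0 \<le> r" "r \<le> s" for r s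
    using that t power_mono[of r s 2] by (simp add: c_def)
  have cpos: "0 < c s" if "0 < s" "s < b" for s
  proof -
    have "s\<^sup>2 < b\<^sup>2" using that by (intro power_strict_mono) auto
    then have "c b < c s" using t by (simp add: c_def)
    then show ?thesis unfolding cb using zero_le_power2[of W] by linarith
  qed
  have "0 \<le> G x"
  proof (rule quasiconcave_nonneg[where f = G and f' = G' and a = 0 and b = b])
    show "continuous_on {0..b} G" unfolding G_def c_def
      by (intro continuous_intros)
    have "0 \<le> c 0" using t nonneg by (simp add: c_def)
    then have "0 \<le> gap t a (W\<^sup>2) (c 0) 0"
      using t nonneg
      by (intro gap_nonneg_if_tangent_at_0) (auto simp: c_def)
    then show "0 \<le> G 0" by (simp add: G)
    show "0 \<le> G b" using fin by (simp add: G)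
    show "(G has_real_derivative G' s) (at s)" if "0 < s" "s < b" for s
    proof -
      have "(c has_real_derivative - (2 * t * (1 - t) * s)) (at s)"
        unfolding c_def by (auto intro!: derivative_eq_intros)
      then have "((\<lambda>s. psi (c s)) has_real_derivative - exp (sqrt (c s)) / 2 * - (2 * t * (1 - t) * s)) (at s)"
        by (rule DERIV_chain2[OF has_derivative_psi, rotated]) (use cpos that in auto)
      then have "(G has_real_derivative (t * exp (t * s) * psi (c s)
          + exp (t * s) * (- exp (sqrt (c s)) / 2 * - (2 * t * (1 - t) * s)) - t * exp s * psi (W\<^sup>2))) (at s)"
        unfolding G_def by (auto intro!: derivative_eq_intros)
      moreover have e: "exp (t * s) * exp (sqrt (c s)) * exp (p s) = exp s * exp W"
        by (simp add: p_def algebra_simps flip: exp_add)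
      have "t * exp (t * s) * psi (c s)
          + exp (t * s) * (- exp (sqrt (c s)) / 2 * - (2 * t * (1 - t) * s)) - t * exp s * psi (W\<^sup>2) 
          = t * (exp (t * s) * exp (sqrt (c s)) * (1 + p s - W) - exp s * exp W * (1 - W))"
        using W by (simp add: psi_def p_def algebra_simps)
      then have "t * exp (t * s) * psi (c s)
          + exp (t * s) * (- exp (sqrt (c s)) / 2 * - (2 * t * (1 - t) * s)) - t * exp s * psi (W\<^sup>2) = G' s"
        unfolding e[symmetric] G'_def exp_add by (simp add: algebra_simps)
      ultimately show ?thesis by simp
    qed
    show "G' r \<le> 0" if "0 < s" "s < r" "r < b" "G s < 0" "G' s < 0" for s r
    proof -
      have "gap t a (W\<^sup>2) (c s) s < 0" using that by (simp add: G mult_less_0_iff)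
      then have "0 < p s"
        using gap_neg_imp(1)[of t s a "W\<^sup>2" "c s"] that t W nonneg cpos[of s]
        by (simp add: c_def p_def)
      moreover have "p s \<le> p r"
      proof -
        have "sqrt (c r) \<le> sqrt (c s)" using c_anti[of s r] that by simp
        moreover have "(1 - t) * s \<le> (1 - t) * r" using that t by (intro mult_left_mono) auto
        ultimately show ?thesis unfolding p_def by linarith
      qed
      moreover have "1 + p s - W - exp (p s) * (1 - W) < 0"
        using that t by (simp add: G'_def mult_less_0_iff)
      ultimately have "1 + p r - W - exp (p r) * (1 - W) \<le> 0"
        using W by (intro tilt_sign)
      then show ?thesis using t by (simp add: G'_def mult_le_0_iff)
    qed
    show "x \<in> {0..b}" using x by simp
  qed
  then show ?thesis by (simp add: G zero_le_mult_iff)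
qed

text \<open>Average and upper point both have the value \<open>W\<^sup>2\<close>, and the balance
  dictates the lower value at each distance. At distance 0 all three points coincide and the gap
  vanishes; at \<open>D\<close> the configuration is the extremal one.\<close>

lemma gap_slide_lower:
  fixes t W D x :: real
  assumes t: "0 < t" "t < 1" and W: "0 \<le> W" "W \<le> 1" and x: "0 \<le> x" "x \<le> D"
    and fin: "0 \<le> gap t (W\<^sup>2 + t * D\<^sup>2) (W\<^sup>2) (W\<^sup>2) D"
  shows "0 \<le> gap t (W\<^sup>2 + t * x\<^sup>2) (W\<^sup>2) (W\<^sup>2) x"
proof -
  define a where "a = (\<lambda>s. W\<^sup>2 + t * s\<^sup>2)"
  define G where "G = (\<lambda>s. gap t (a s) (W\<^sup>2) (W\<^sup>2) s)"
  define p where "p = (\<lambda>s. s + W - sqrt (a s))"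
  define G' where "G' = (\<lambda>s. t * (1 - t) * exp (sqrt (a s) - t * s) * (1 + p s - W - exp (p s) * (1 - W)))"
  have apos: "0 < a s" if "0 < s" for s
    using that t by (simp add: a_def add_nonneg_pos)
  \<comment> \<open>The root of \<open>W\<^sup>2 + t * s\<^sup>2\<close> has slope at most 1.
    Squaring instead of differentiating also covers the kink at 0 when \<open>W = 0\<close>.\<close>
  have p_mono: "p r \<le> p s" if "0 \<le> r" "r \<le> s" for r s
  proof -
    have "a s \<le> (sqrt (a r) + (s - r))\<^sup>2"
    proof -
      have "r\<^sup>2 \<le> s\<^sup>2" using that by (simp add: power_mono)
      have "t * r \<le> sqrt (a r)"
      proof (rule real_le_rsqrt)
        have "t * t \<le> 1 * t" using t by (intro mult_right_mono) auto
        then have "t * t * r\<^sup>2 \<le> 1 * t * r\<^sup>2" by (rule mult_right_mono) simp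
        then have "(t * r)\<^sup>2 \<le> t * r\<^sup>2" by (simp add: power2_eq_square mult_ac)
        then show "(t * r)\<^sup>2 \<le> a r" unfolding a_def using zero_le_power2[of W] by linarith
      qed
      then have "2 * (s - r) * (t * r) \<le> 2 * (s - r) * sqrt (a r)"
        using that by (intro mult_left_mono) auto
      moreover have "t * (s - r)\<^sup>2 \<le> 1 * (s - r)\<^sup>2" using t by (intro mult_right_mono) auto
      moreover have "(sqrt (a r))\<^sup>2 = a r" using t by (simp add: a_def)
      ultimately show ?thesis
        by (simp add: power2_sum a_def) (simp add: algebra_simps power2_eq_square)
    qed
    then have "sqrt (a s) \<le> sqrt (a r) + (s - r)"
      using that t by (intro real_le_lsqrt) (auto simp: a_def)
    then show ?thesis by (simp add: p_def)
  qed
  have "0 \<le> G x"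
  proof (rule quasiconcave_nonneg[where f = G and f' = G' and a = 0 and b = D])
    show "continuous_on {0..D} G" unfolding G_def a_def gap_def
      by (intro continuous_intros)
    show "0 \<le> G 0" by (simp add: G_def gap_def a_def algebra_simps)
    show "0 \<le> G D" using fin by (simp add: G_def a_def)
    show "(G has_real_derivative G' s) (at s)" if "0 < s" "s < D" for s
    proof -
      have "(a has_real_derivative 2 * t * s) (at s)"
        unfolding a_def by (auto intro!: derivative_eq_intros)
      then have "((\<lambda>s. psi (a s)) has_real_derivative - exp (sqrt (a s)) / 2 * (2 * t * s)) (at s)"
        by (rule DERIV_chain2[OF has_derivative_psi, rotated]) (use apos that in auto)
      then have "(G has_real_derivative
          ((1 - t) * t * exp (- (t * s)) * psi (a s)
           - (1 - t) * exp (- (t * s)) * (- exp (sqrt (a s)) / 2 * (2 * t * s))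
           - t * (1 - t) * exp ((1 - t) * s) * psi (W\<^sup>2))) (at s)"
        unfolding G_def gap_def by (auto intro!: derivative_eq_intros)
      moreover have e: "exp (sqrt (a s) - t * s) * exp (p s) = exp ((1 - t) * s) * exp W"
        by (simp add: p_def algebra_simps flip: exp_add)
      have "(1 - t) * t * exp (- (t * s)) * psi (a s)
           - (1 - t) * exp (- (t * s)) * (- exp (sqrt (a s)) / 2 * (2 * t * s))
           - t * (1 - t) * exp ((1 - t) * s) * psi (W\<^sup>2)
          = t * (1 - t) * (exp (- (t * s)) * exp (sqrt (a s)) * (1 + p s - W)
             - exp ((1 - t) * s) * exp W * (1 - W))"
        using W by (simp add: psi_def p_def algebra_simps)
      then have "(1 - t) * t * exp (- (t * s)) * psi (a s)
           - (1 - t) * exp (- (t * s)) * (- exp (sqrt (a s)) / 2 * (2 * t * s))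
           - t * (1 - t) * exp ((1 - t) * s) * psi (W\<^sup>2) = G' s"
        unfolding e[symmetric] G'_def by (simp add: exp_diff exp_minus divide_simps) (simp add: algebra_simps)
      ultimately show ?thesis by simp
    qed
    show "G' r \<le> 0" if "0 < s" "s < r" "r < D" "G s < 0" "G' s < 0" for s r
    proof -
      have m: "1 + p s - W - exp (p s) * (1 - W) < 0"
        using that t by (simp add: G'_def mult_less_0_iff)
      have "0 \<le> p s" using p_mono[of 0 s] that W by (simp add: p_def a_def)
      moreover have "p s \<noteq> 0" using m by auto
      ultimately have "0 < p s" by simp
      then have "1 + p r - W - exp (p r) * (1 - W) \<le> 0"
        using p_mono[of s r] that W m by (intro tilt_sign[of "p s"]) auto
      then show ?thesis using t by (simp add: G'_def mult_le_0_iff)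
    qed
    show "x \<in> {0..D}" using x by simp
  qed
  then show ?thesis by (simp add: G_def a_def)
qed

text \<open>The three slides are chained backwards. Shrinking the distance ends with equal means or
  with the upper value at \<open>W\<^sup>2\<close>; in the second case, enlarging it brings the
  average to \<open>W\<^sup>2\<close>, and enlarging it further ends at \<open>D\<close>.
  Nonnegativity is carried back from each end.\<close>

lemma gap_nonneg_base:
  fixes t W D a y c x :: real
  assumes t: "0 < t" "t < 1" and W: "0 \<le> W" "W \<le> 1" and D: "0 \<le> D"
    and fin: "0 \<le> gap t (W\<^sup>2 + t * D\<^sup>2) (W\<^sup>2) (W\<^sup>2) D"
    and a: "0 \<le> a" "a \<le> W\<^sup>2 + t * D\<^sup>2" and y: "W\<^sup>2 \<le> y" and c: "W\<^sup>2 \<le> c" and x: "0 \<le> x"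
    and rel: "c = (1 - t) * a + t * y - t * (1 - t) * x\<^sup>2"
  shows "0 \<le> gap t a y c x"
proof -
  define f where "f = (\<lambda>s. (c - (1 - t) * a) / t + (1 - t) * s\<^sup>2)"
  have fx: "f x = y" using rel t by (simp add: f_def field_simps)
  have c0: "0 \<le> c" using c zero_le_power2[of W] by linarith
  show ?thesis
  proof (cases "W\<^sup>2 \<le> f 0")
    case True
    then have f0: "0 \<le> f 0" using zero_le_power2[of W] by linarith
    then have "0 \<le> gap t a (f 0) c 0"
      using t a c0 by (intro gap_nonneg_if_tangent_at_0) (auto simp: f_def field_simps)
    then have "0 \<le> gap t a (f x) c x"
      unfolding f_def by - (rule gap_slide_upper[where u = 0], use t a c0 x f0 in \<open>simp_all add: f_def\<close>)
    then show ?thesis by (simp add: fx)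
  next
    case False
    \<comment> \<open>The distance at which the upper value has dropped to
      \<open>W\<^sup>2\<close>.\<close>
    define u where "u = sqrt ((W\<^sup>2 - f 0) / (1 - t))"
    have u0: "0 \<le> u" and u2: "(1 - t) * u\<^sup>2 = W\<^sup>2 - f 0"
      using False t by (auto simp: u_def)
    have fu: "f u = W\<^sup>2" using u2 by (simp add: f_def)
    have "(1 - t) * u\<^sup>2 \<le> (1 - t) * x\<^sup>2" using u2 fx y by (simp add: f_def)
    then have ux: "u \<le> x" by - (rule power2_le_imp_le, use t x in simp_all)
    have cu: "c = (1 - t) * a + t * W\<^sup>2 - t * (1 - t) * u\<^sup>2"
      using fu t by (simp add: f_def field_simps)
    \<comment> \<open>The distance at which the average also has the value \<open>W\<^sup>2\<close>;
      the upper bound on \<open>a\<close> gives \<open>b \<le> D\<close>.\<close>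
    define b where "b = sqrt ((a - W\<^sup>2) / t)"
    have "0 \<le> t * (1 - t) * u\<^sup>2" using t by simp
    then have "(1 - t) * W\<^sup>2 \<le> (1 - t) * a" using cu c by (simp add: algebra_simps)
    then have aW: "W\<^sup>2 \<le> a" using t by simp
    then have b0: "0 \<le> b" and b2: "t * b\<^sup>2 = a - W\<^sup>2"
      using t by (auto simp: b_def)
    have "t * (1 - t) * u\<^sup>2 \<le> (1 - t) * (a - W\<^sup>2)" using cu c by (simp add: algebra_simps)
    also have "\<dots> = t * (1 - t) * b\<^sup>2" by (simp flip: b2)
    finally have ub: "u \<le> b" by - (rule power2_le_imp_le, use t b0 in simp_all)
    have "t * b\<^sup>2 \<le> t * D\<^sup>2" using b2 a by simp
    then have bD: "b \<le> D" by - (rule power2_le_imp_le, use t D in simp_all)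
    have "0 \<le> gap t a (W\<^sup>2) (W\<^sup>2) b"
      using gap_slide_lower[OF t W b0 bD fin] by (simp add: b2)
    moreover have cb: "(1 - t) * a + t * W\<^sup>2 - t * (1 - t) * b\<^sup>2 = W\<^sup>2"
      using arg_cong[OF b2, of "\<lambda>v. (1 - t) * v"] by (simp add: algebra_simps)
    ultimately have "0 \<le> gap t a (W\<^sup>2) c u"
      using gap_slide_mid[OF t a(1) W u0 ub cb] by (simp add: cu)
    then have "0 \<le> gap t a (f u) c u" by (simp add: fu)
    then have "0 \<le> gap t a (f x) c x"
      unfolding f_def
      by - (rule gap_slide_upper[where u = u], use t a c0 u0 ux fu in \<open>simp_all add: f_def\<close>)
    then show ?thesis by (simp add: fx)
  qed
qed

text \<open>If the upper point lies beyond the tangent line through the average, the segment from the lower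
  point to the average stays in the strip \<open>V \<le> \<delta>\<^sup>2\<close>, where the candidate is concave, so the lower
  point may be moved towards the average until the upper weight drops to \<open>\<alpha>\<close>.\<close>

lemma gap_nonneg:
  fixes \<alpha> t W D a y c x :: real
  assumes \<alpha>: "0 < \<alpha>" "\<alpha> \<le> t" and t: "t < 1" and W: "0 \<le> W" "W \<le> 1" and D: "0 \<le> D"
    and fin: "0 \<le> gap \<alpha> (W\<^sup>2 + \<alpha> * D\<^sup>2) (W\<^sup>2) (W\<^sup>2) D"
    and a: "0 \<le> a" "a \<le> W\<^sup>2 + \<alpha> * D\<^sup>2" and y: "W\<^sup>2 \<le> y"
    and c: "W\<^sup>2 \<le> c" "c \<le> W\<^sup>2 + \<alpha> * D\<^sup>2" and x: "0 \<le> x"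
    and rel: "c = (1 - t) * a + t * y - t * (1 - t) * x\<^sup>2"
  shows "0 \<le> gap t a y c x"
proof (rule ccontr)
  assume "\<not> 0 \<le> gap t a y c x"
  moreover have nonneg: "0 \<le> c" "0 \<le> y" using c y zero_le_power2[of W] by linarith+
  ultimately have TY: "y < ((1 - t) * x - sqrt c)\<^sup>2"
    using gap_neg_imp(2)[of t x a y c] \<alpha> t x a rel by simp
  \<comment> \<open>Dictated by the balance of means: the point a fraction \<open>l\<close> of the
    way from the average to the lower point has mean \<open>- h\<close>, and with weight
    \<open>1 - \<alpha>\<close> it balances the upper point with weight \<alpha>. Its value of
    \<open>\<delta>\<^sup>2 - V\<close> is \<open>b\<close>.\<close>
  define l where "l = \<alpha> * (1 - t) / ((1 - \<alpha>) * t)"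
  define h where "h = l * (t * x)"
  define b where "b = h\<^sup>2 - l * (t\<^sup>2 * x\<^sup>2 - a) + (1 - l) * c"
  have \<alpha>1: "\<alpha> < 1" using \<alpha> t by simp
  have l: "0 < l" "l \<le> 1"
  proof -
    show "0 < l" using \<alpha> \<alpha>1 t by (simp add: l_def)
    have "\<alpha> * (1 - t) \<le> (1 - \<alpha>) * t" using \<alpha> by (simp add: algebra_simps)
    then show "l \<le> 1" using \<alpha> \<alpha>1 t by (simp add: l_def)
  qed
  have ll: "l * ((1 - \<alpha>) * t) = \<alpha> * (1 - t)" using \<alpha> \<alpha>1 t by (simp add: l_def)
  then have l2: "(1 - \<alpha>) * l = \<alpha> * (1 - t) / t" using \<alpha> by (simp add: field_simps)
  define r where "r = sqrt c"
  have r: "0 \<le> r" "r\<^sup>2 = c" using nonneg by (auto simp: r_def)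
  have h0: "0 \<le> h" using l \<alpha> x by (simp add: h_def)
  \<comment> \<open>The weighted offsets from the tangent line through the average cancel. The upper
    point lies strictly beyond the line, hence the lower point, and with it the intermediate one,
    lies on the other side.\<close>
  have "(1 - t) * ((t * x + r)\<^sup>2 - a) + t * (((1 - t) * x - r)\<^sup>2 - y) = 0"
    using rel by (simp flip: r(2) add: algebra_simps power2_eq_square)
  moreover have "0 < t * (((1 - t) * x - r)\<^sup>2 - y)" using TY \<alpha> by (simp add: r_def)
  ultimately have "(1 - t) * ((t * x + r)\<^sup>2 - a) < 0" by linarith
  then have "(t * x + r)\<^sup>2 - a < 0" using t by (simp add: mult_less_0_iff)
  then have "l * ((t * x + r)\<^sup>2 - a) \<le> 0" using l by (simp add: mult_le_0_iff)
  moreover have "(h + r)\<^sup>2 - b = l * ((t * x + r)\<^sup>2 - a)"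
    by (simp add: b_def h_def flip: r(2)) (simp add: algebra_simps power2_eq_square)
  ultimately have hb: "(h + r)\<^sup>2 \<le> b" by simp
  then have b0: "0 \<le> b" using zero_le_power2[of "h + r"] by linarith
  have relb: "b = l * a + (1 - l) * c - (1 - l) * l * (t * x)\<^sup>2"
    by (simp add: b_def h_def algebra_simps power2_eq_square)
  have "b \<le> l * a + (1 - l) * c" using l by (simp add: relb)
  also have "\<dots> \<le> l * (W\<^sup>2 + \<alpha> * D\<^sup>2) + (1 - l) * (W\<^sup>2 + \<alpha> * D\<^sup>2)"
    using l a c by (intro add_mono mult_left_mono) auto
  finally have bD: "b \<le> W\<^sup>2 + \<alpha> * D\<^sup>2" by (simp add: algebra_simps)
  define z where "z = (1 - t) * x + h"
  have hz: "h = \<alpha> * z"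
    using arg_cong[OF ll, of "\<lambda>v. v * x"] unfolding z_def h_def by (simp add: algebra_simps)
  then have z: "(1 - \<alpha>) * z = (1 - t) * x" by (simp add: z_def algebra_simps)
  have "c = (1 - \<alpha>) * b + \<alpha> * y - \<alpha> * (1 - \<alpha>) * z\<^sup>2"
  proof -
    have "t * ((1 - \<alpha>) * b + \<alpha> * y - \<alpha> * (1 - \<alpha>) * z\<^sup>2 - c) = 0"
    proof -
      have "t * ((1 - \<alpha>) * b) = (1 - \<alpha>) * t * h\<^sup>2 - l * ((1 - \<alpha>) * t) * (t\<^sup>2 * x\<^sup>2 - a)
          + (1 - \<alpha>) * t * c - l * ((1 - \<alpha>) * t) * c"
        by (simp add: b_def algebra_simps)
      then have "t * ((1 - \<alpha>) * b) = (1 - \<alpha>) * t * (\<alpha> * z)\<^sup>2 - \<alpha> * (1 - t) * (t\<^sup>2 * x\<^sup>2 - a)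
          + (1 - \<alpha>) * t * c - \<alpha> * (1 - t) * c"
        unfolding ll hz .
      moreover have "\<alpha> * (t * y) = \<alpha> * (c - (1 - t) * a + t * (1 - t) * x\<^sup>2)" using rel by simp
      moreover have "t * ((1 - \<alpha>) * b + \<alpha> * y - \<alpha> * (1 - \<alpha>) * z\<^sup>2 - c)
          = t * ((1 - \<alpha>) * b) + \<alpha> * (t * y) - t * \<alpha> * (1 - \<alpha>) * z\<^sup>2 - t * c"
        by (simp add: algebra_simps)
      ultimately have "t * ((1 - \<alpha>) * b + \<alpha> * y - \<alpha> * (1 - \<alpha>) * z\<^sup>2 - c)
          = t * \<alpha> * ((1 - t) * x)\<^sup>2 - t * \<alpha> * ((1 - \<alpha>) * z)\<^sup>2"
        by (simp add: algebra_simps power2_eq_square)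
      then show ?thesis by (simp add: z)
    qed
    then show ?thesis using \<alpha> by simp
  qed
  then have base: "0 \<le> gap \<alpha> b y c z"
    using gap_nonneg_base[of \<alpha> W D b y c z] \<alpha> \<alpha>1 W D fin b0 bD y c h0 x t
    by (simp add: z_def)
  \<comment> \<open>Here the intermediate point is the average of the lower point and the old
    average, which plays the upper point; \<open>hb\<close> places its tangency point no further
    right than that of the intermediate point.\<close>
  have conc: "0 \<le> gap (1 - l) a c b (t * x)"
  proof (rule gap_nonneg_if_tangent)
    have "h + r \<le> sqrt b" using hb h0 r by (intro real_le_rsqrt)
    then show "((1 - (1 - l)) * (t * x) - sqrt b)\<^sup>2 \<le> c \<or> (1 - (1 - l)) * (t * x) + sqrt c \<le> sqrt b"
      by (simp add: h_def r_def)
  qed (use l \<alpha> x a b0 nonneg relb in auto)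
  have "(1 - \<alpha>) * exp (- h) * (l * exp (- ((1 - l) * (t * x))) * psi a + (1 - l) * exp h * psi c)
      \<le> (1 - \<alpha>) * exp (- h) * psi b"
    using conc \<alpha>1 by (intro mult_left_mono) (auto simp: gap_def h_def)
  moreover have "exp (- h) * exp (- ((1 - l) * (t * x))) = exp (- (t * x))"
    by (simp add: h_def algebra_simps flip: exp_add)
  moreover have "exp (- h) * exp h = 1" by (simp flip: exp_add)
  moreover have "(1 - \<alpha>) * exp (- h) * (l * exp (- ((1 - l) * (t * x))) * psi a + (1 - l) * exp h * psi c)
      = (1 - \<alpha>) * l * (exp (- h) * exp (- ((1 - l) * (t * x))) * psi a)
        + (1 - \<alpha>) * (1 - l) * (exp (- h) * exp h) * psi c"
    by (simp add: algebra_simps)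
  ultimately have 1: "(1 - \<alpha>) * l * (exp (- (t * x)) * psi a) + (1 - \<alpha>) * (1 - l) * psi c
      \<le> (1 - \<alpha>) * exp (- h) * psi b"
    by simp
  have "(1 - \<alpha>) * exp (- h) * psi b + \<alpha> * exp ((1 - t) * x) * psi y \<le> psi c"
    using base unfolding gap_def z hz[symmetric] by simp
  \<comment> \<open>Collecting \<open>psi c\<close> leaves the coefficient
    \<open>\<alpha> + (1 - \<alpha>) * l = \<alpha> / t\<close>, hence the factor
    \<open>t / \<alpha>\<close> below.\<close>
  with 1 have "(1 - \<alpha>) * l * (exp (- (t * x)) * psi a) + \<alpha> * exp ((1 - t) * x) * psi y
     \<le> (\<alpha> + (1 - \<alpha>) * l) * psi c"
    by (simp add: algebra_simps)
  then have "t / \<alpha> * ((1 - \<alpha>) * l * (exp (- (t * x)) * psi a) + \<alpha> * exp ((1 - t) * x) * psi y)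
     \<le> t / \<alpha> * ((\<alpha> + (1 - \<alpha>) * l) * psi c)"
    using \<alpha> by (intro mult_left_mono) auto
  moreover have "t / \<alpha> * ((1 - \<alpha>) * l * X + \<alpha> * Y * Z) = (1 - t) * X + t * Y * Z" for X Y Z
    unfolding l2 using \<alpha> by (simp add: field_simps)
  moreover have "t / \<alpha> * ((\<alpha> + (1 - \<alpha>) * l) * X) = X" for X
    unfolding l2 using \<alpha> by (simp add: field_simps)
  ultimately have "0 \<le> gap t a y c x" by (simp add: gap_def)
  then show False using \<open>\<not> 0 \<le> gap t a y c x\<close> by simp
qed

section \<open>Choice of the radius\<close>

text \<open>With \<open>y = sqrt \<alpha>\<close> and \<open>x = \<epsilon> / sqrt \<alpha>\<close>
  this compares the claimed constant with \<open>1 / psi (\<epsilon>\<^sup>2)\<close>, which the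
  radius \<epsilon> would give: the claimed one is not smaller. It settles the left end in the
  search for the radius.\<close>

lemma continuous_bound_aux:
  fixes x y :: real
  assumes y: "0 < y" "y < 1" and x: "0 \<le> x"
  shows "exp (- ((1 - y) * y * x)) - y\<^sup>2 * exp ((1 - y) * x) \<le> (1 - y\<^sup>2) * (1 - y * x)"
proof -
  define f where "f = (\<lambda>x. (1 - y\<^sup>2) * (1 - y * x) - exp (- ((1 - y) * y * x)) + y\<^sup>2 * exp ((1 - y) * x))"
  have "f 0 \<le> f x"
  proof (rule DERIV_nonneg_imp_nondecreasing[OF x])
    fix z :: real
    have "(f has_real_derivative
        y * (1 - y) * (exp (- ((1 - y) * y * z)) + y * exp ((1 - y) * z) - 1 - y)) (at z)"
      unfolding f_def
      by (auto intro!: derivative_eq_intros simp: algebra_simps power2_eq_square)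
    moreover have "1 - (1 - y) * y * z + y * (1 + (1 - y) * z)
        \<le> exp (- ((1 - y) * y * z)) + y * exp ((1 - y) * z)"
      using exp_ge_add_one_self[of "- ((1 - y) * y * z)"] exp_ge_add_one_self[of "(1 - y) * z"] y
      by (intro add_mono mult_left_mono) auto
    then have "0 \<le> exp (- ((1 - y) * y * z)) + y * exp ((1 - y) * z) - 1 - y"
      by (simp add: algebra_simps)
    ultimately show "\<exists>l. (f has_real_derivative l) (at z) \<and> 0 \<le> l"
      using y by fastforce
  qed
  then show ?thesis by (simp add: f_def)
qed

text \<open>The radius is \<open>\<delta> = sqrt (W\<^sup>2 + \<epsilon>\<^sup>2)\<close>. At \<open>\<epsilon> = 0\<close> every radius solves the equation; otherwise one
  between \<open>\<epsilon>\<close> and 1 does.\<close>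

lemma exists_radius:
  fixes \<alpha> \<epsilon> :: real
  assumes \<alpha>: "0 < \<alpha>" "\<alpha> < 1" and \<epsilon>: "0 \<le> \<epsilon>" and sub: "\<alpha> * exp ((1 - \<alpha>) * (\<epsilon> / sqrt \<alpha>)) < 1"
  shows "\<exists>W. 0 \<le> W \<and> W\<^sup>2 + \<epsilon>\<^sup>2 < 1 \<and> gap \<alpha> (W\<^sup>2 + \<epsilon>\<^sup>2) (W\<^sup>2) (W\<^sup>2) (\<epsilon> / sqrt \<alpha>) = 0"
proof (cases "\<epsilon> = 0")
  case True
  then show ?thesis
    by (intro exI[of _ "1/2"]) (simp add: gap_def power2_eq_square algebra_simps)
next
  case False
  with \<epsilon> have \<epsilon>: "0 < \<epsilon>" by simp
  define y where "y = sqrt \<alpha>"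
  have y: "0 < y" "y < 1" and \<alpha>y: "\<alpha> = y\<^sup>2" using \<alpha> by (auto simp: y_def)
  define D where "D = \<epsilon> / y"
  have D: "0 < D" and \<epsilon>D: "\<epsilon> = y * D" using \<epsilon> y by (auto simp: D_def)
  define L where "L = 1 - \<alpha> * exp ((1 - \<alpha>) * D)"
  have L: "0 < L" using sub by (simp add: L_def D_def y_def)
  have key: "L \<le> (1 - \<alpha>) * exp (- (\<alpha> * D)) * ((1 - \<epsilon>) * exp \<epsilon>)"
  proof -
    have le: "exp (\<epsilon> - \<alpha> * D) * (exp (- ((1 - y) * y * D)) - y\<^sup>2 * exp ((1 - y) * D))
        \<le> exp (\<epsilon> - \<alpha> * D) * ((1 - y\<^sup>2) * (1 - y * D))"
      using continuous_bound_aux[OF y, of D] D by (intro mult_left_mono) auto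
    have "exp (\<epsilon> - \<alpha> * D) * exp (- ((1 - y) * y * D)) = 1"
      by (simp add: \<epsilon>D \<alpha>y algebra_simps power2_eq_square flip: exp_add)
    moreover have "exp (\<epsilon> - \<alpha> * D) * exp ((1 - y) * D) = exp ((1 - \<alpha>) * D)"
      by (simp add: \<epsilon>D \<alpha>y algebra_simps power2_eq_square flip: exp_add)
    moreover have "exp (\<epsilon> - \<alpha> * D) * (exp (- ((1 - y) * y * D)) - y\<^sup>2 * exp ((1 - y) * D))
      = exp (\<epsilon> - \<alpha> * D) * exp (- ((1 - y) * y * D)) - y\<^sup>2 * (exp (\<epsilon> - \<alpha> * D) * exp ((1 - y) * D))"
      by (simp add: algebra_simps)
    ultimately have "exp (\<epsilon> - \<alpha> * D) * (exp (- ((1 - y) * y * D)) - y\<^sup>2 * exp ((1 - y) * D)) = L"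
      by (simp add: L_def \<alpha>y)
    with le have "L \<le> exp (\<epsilon> - \<alpha> * D) * ((1 - y\<^sup>2) * (1 - y * D))" by (simp only:)
    also have "\<dots> = (1 - \<alpha>) * exp (- (\<alpha> * D)) * ((1 - \<epsilon>) * exp \<epsilon>)"
      unfolding \<alpha>y[symmetric] \<epsilon>D[symmetric] by (simp add: exp_diff exp_minus field_simps)
    finally show ?thesis .
  qed
  have \<epsilon>1: "\<epsilon> < 1"
  proof -
    have "0 < ((1 - \<alpha>) * exp (- (\<alpha> * D)) * exp \<epsilon>) * (1 - \<epsilon>)"
      using L key by (simp add: mult_ac)
    moreover have "0 < (1 - \<alpha>) * exp (- (\<alpha> * D)) * exp \<epsilon>" using \<alpha> by simp
    ultimately show ?thesis by (simp add: zero_less_mult_iff)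
  qed
  \<comment> \<open>The gap of the extremal configuration as a function of the radius
    \<open>r\<close>, with \<open>W\<^sup>2 = r\<^sup>2 - \<epsilon>\<^sup>2\<close>. Its sign at
    \<epsilon> is \<open>key\<close>; at 1 the subtracted term vanishes because
    \<open>psi 1 = 0\<close>.\<close>
  define K where "K = (\<lambda>r. psi (r\<^sup>2 - \<epsilon>\<^sup>2) * L - (1 - \<alpha>) * exp (- (\<alpha> * D)) * psi (r\<^sup>2))"
  have "\<exists>r\<ge>\<epsilon>. r \<le> 1 \<and> K r = 0"
  proof (rule IVT')
    show "K \<epsilon> \<le> 0" using key \<epsilon> by (simp add: K_def psi_power2) (simp add: psi_def)
    have "\<epsilon>\<^sup>2 \<le> 1" using \<epsilon> \<epsilon>1 by (simp add: power_le_one)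
    then have "0 \<le> psi (1 - \<epsilon>\<^sup>2)" by (intro psi_nonneg) auto
    then show "0 \<le> K 1" using L by (simp add: K_def) (simp add: psi_def)
    show "continuous_on {\<epsilon>..1} K" unfolding K_def by (intro continuous_intros)
  qed (use \<epsilon>1 in simp)
  then obtain r where r: "\<epsilon> \<le> r" "r \<le> 1" "K r = 0" by auto
  \<comment> \<open>Radius 1 would make the divisor \<open>psi (\<delta>\<^sup>2)\<close> of the
    candidate zero.\<close>
  have "r \<noteq> 1"
  proof
    assume "r = 1"
    have "0 < psi (1 - \<epsilon>\<^sup>2)" using \<epsilon> by (intro psi_pos) auto
    then have "0 < K 1" using L by (simp add: K_def) (simp add: psi_def)
    then show False using r \<open>r = 1\<close> by simp
  qed
  define W where "W = sqrt (r\<^sup>2 - \<epsilon>\<^sup>2)"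
  have "\<epsilon>\<^sup>2 \<le> r\<^sup>2" using r \<epsilon> by (intro power_mono) auto
  then have W: "0 \<le> W" "W\<^sup>2 = r\<^sup>2 - \<epsilon>\<^sup>2" by (auto simp: W_def)
  have "r\<^sup>2 < 1" using r \<open>r \<noteq> 1\<close> \<epsilon> by (simp add: power_less_one_iff abs_square_less_1)
  then have "W\<^sup>2 + \<epsilon>\<^sup>2 < 1" by (simp add: W)
  moreover have "gap \<alpha> (W\<^sup>2 + \<epsilon>\<^sup>2) (W\<^sup>2) (W\<^sup>2) (\<epsilon> / sqrt \<alpha>) = K r"
    by (simp add: W gap_def K_def L_def D_def y_def algebra_simps)
  ultimately show ?thesis using r W by auto
qed

section \<open>From two points to all children of a cube\<close>

lemma bellman_two_point:
  fixes \<alpha> t W \<epsilon> h1 h2 v1 v2 V :: real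
  assumes \<alpha>: "0 < \<alpha>" "\<alpha> \<le> t" "t \<le> 1 - \<alpha>" and W: "0 \<le> W" "W\<^sup>2 + \<epsilon>\<^sup>2 < 1" and \<epsilon>: "0 \<le> \<epsilon>"
    and fin: "0 \<le> gap \<alpha> (W\<^sup>2 + \<epsilon>\<^sup>2) (W\<^sup>2) (W\<^sup>2) (\<epsilon> / sqrt \<alpha>)"
    and v: "0 \<le> v1" "v1 \<le> \<epsilon>\<^sup>2" "0 \<le> v2" "v2 \<le> \<epsilon>\<^sup>2" "V \<le> \<epsilon>\<^sup>2"
    and rel: "V = (1 - t) * v1 + t * v2 + t * (1 - t) * (h2 - h1)\<^sup>2"
  shows "(1 - t) * (exp h1 * psi (W\<^sup>2 + \<epsilon>\<^sup>2 - v1)) + t * (exp h2 * psi (W\<^sup>2 + \<epsilon>\<^sup>2 - v2))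
    \<le> exp ((1 - t) * h1 + t * h2) * psi (W\<^sup>2 + \<epsilon>\<^sup>2 - V)"
proof -
  have "W\<^sup>2 < 1" using W zero_le_power2[of \<epsilon>] by linarith
  then have W1: "W \<le> 1" using W by (simp add: abs_square_less_1)
  have main: "(1 - t) * (exp h1 * psi (W\<^sup>2 + \<epsilon>\<^sup>2 - v1)) + t * (exp h2 * psi (W\<^sup>2 + \<epsilon>\<^sup>2 - v2))
    \<le> exp ((1 - t) * h1 + t * h2) * psi (W\<^sup>2 + \<epsilon>\<^sup>2 - V)"
    if "h1 \<le> h2" "\<alpha> \<le> t" "t \<le> 1 - \<alpha>" "0 \<le> v1" "v1 \<le> \<epsilon>\<^sup>2" "0 \<le> v2" "v2 \<le> \<epsilon>\<^sup>2"
      and rel: "V = (1 - t) * v1 + t * v2 + t * (1 - t) * (h2 - h1)\<^sup>2" for t h1 h2 v1 v2 :: real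
  proof -
    have le: "u \<le> W\<^sup>2 + \<epsilon>\<^sup>2" if "u \<le> \<epsilon>\<^sup>2" for u
      using that zero_le_power2[of W] by linarith
    have "\<alpha> * (\<epsilon> / sqrt \<alpha>)\<^sup>2 = \<epsilon>\<^sup>2" using \<alpha> by (simp add: power_divide)
    moreover have "0 \<le> V" unfolding rel using that \<alpha> by (intro add_nonneg_nonneg mult_nonneg_nonneg) auto
    ultimately have "0 \<le> gap t (W\<^sup>2 + \<epsilon>\<^sup>2 - v1) (W\<^sup>2 + \<epsilon>\<^sup>2 - v2) (W\<^sup>2 + \<epsilon>\<^sup>2 - V) (h2 - h1)"
      using that \<alpha> W W1 \<epsilon> fin v
      by (intro gap_nonneg[of \<alpha> t W "\<epsilon> / sqrt \<alpha>"]) (auto simp: algebra_simps intro!: le)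
    then have "0 \<le> exp ((1 - t) * h1 + t * h2) *
        gap t (W\<^sup>2 + \<epsilon>\<^sup>2 - v1) (W\<^sup>2 + \<epsilon>\<^sup>2 - v2) (W\<^sup>2 + \<epsilon>\<^sup>2 - V) (h2 - h1)" by simp
    moreover have "exp ((1 - t) * h1 + t * h2) * exp (- (t * (h2 - h1))) = exp h1"
      "exp ((1 - t) * h1 + t * h2) * exp ((1 - t) * (h2 - h1)) = exp h2"
      by (simp_all add: algebra_simps flip: exp_add)
    moreover have "E * gap t a y c x =
        E * psi c - (1 - t) * (E * exp (- (t * x)) * psi a) - t * (E * exp ((1 - t) * x) * psi y)" for E a y c x
      by (simp add: gap_def algebra_simps)
    ultimately show ?thesis by simp
  qed
  show ?thesis
  proof (cases "h1 \<le> h2")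
    case True
    then show ?thesis using main[of h1 h2 t v1 v2] \<alpha> v rel by simp
  next
    case False
    \<comment> \<open>Exchanging the points turns \<open>t\<close> into \<open>1 - t\<close>, which
      explains the bound on \<open>t\<close> from both sides.\<close>
    have "V = (1 - (1 - t)) * v2 + (1 - t) * v1 + (1 - t) * (1 - (1 - t)) * (h1 - h2)\<^sup>2"
      unfolding rel power2_commute[of h1] by simp
    from main[OF _ _ _ _ _ _ _ this] show ?thesis using False \<alpha> v by (simp add: add.commute)
  qed
qed

lemma moments_nonneg:
  fixes h q :: "'a \<Rightarrow> real"
  assumes "finite I" "\<And>i. i \<in> I \<Longrightarrow> (h i)\<^sup>2 \<le> q i"
  shows "(sum h I / card I)\<^sup>2 \<le> sum q I / card I"
proof (cases "I = {}")
  case False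
  then have M: "0 < real (card I)" using assms by (simp add: card_gt_0_iff)
  have "(sum h I)\<^sup>2 \<le> (\<Sum>i\<in>I. (h i)\<^sup>2) * card I"
    by (rule sum_squared_le_sum_of_squares)
  also have "\<dots> \<le> sum q I * card I" by (intro mult_right_mono sum_mono assms) auto
  finally show ?thesis using M by (simp add: power_divide power2_eq_square field_simps)
qed simp

text \<open>Removing a point whose squared deviation is at least the variance does not increase the variance
  of the others, so the induction stays inside the domain.\<close>

lemma bellman_main_inequality:
  fixes N :: nat and W \<epsilon> :: real and h q :: "'a \<Rightarrow> real"
  assumes W: "0 \<le> W" "W\<^sup>2 + \<epsilon>\<^sup>2 < 1" and \<epsilon>: "0 \<le> \<epsilon>"
    and fin: "0 \<le> gap (1 / N) (W\<^sup>2 + \<epsilon>\<^sup>2) (W\<^sup>2) (W\<^sup>2) (\<epsilon> / sqrt (1 / N))"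
    and "finite I" "I \<noteq> {}" "card I \<le> N"
    and "\<And>i. i \<in> I \<Longrightarrow> (h i)\<^sup>2 \<le> q i" "\<And>i. i \<in> I \<Longrightarrow> q i - (h i)\<^sup>2 \<le> \<epsilon>\<^sup>2"
    and "sum q I / card I - (sum h I / card I)\<^sup>2 \<le> \<epsilon>\<^sup>2"
  shows "(\<Sum>i\<in>I. exp (h i) * psi (W\<^sup>2 + \<epsilon>\<^sup>2 - (q i - (h i)\<^sup>2)))
    \<le> card I * (exp (sum h I / card I) * psi (W\<^sup>2 + \<epsilon>\<^sup>2 - (sum q I / card I - (sum h I / card I)\<^sup>2)))"
  using assms(5-)
proof (induction "card I" arbitrary: I)
  case 0
  then show ?case by simp
next
  case (Suc k)
  define M where "M = real (card I)"
  define m where "m = sum h I / M"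
  define s where "s = sum q I / M"
  have M: "0 < M" "M = real k + 1" using Suc by (auto simp: M_def card_gt_0_iff)
  show ?case
  proof (cases "k = 0")
    case True
    then obtain i where "I = {i}" using Suc by (metis One_nat_def card_1_singletonE)
    then show ?thesis by simp
  next
    case False
    \<comment> \<open>\<open>d i\<close> is the second moment of point \<open>i\<close> about the
      common mean \<open>m\<close>. These average to the variance \<open>s - m\<^sup>2\<close>, so
      some \<open>j\<close> attains at least that.\<close>
    define d where "d = (\<lambda>i. q i - 2 * m * h i + m\<^sup>2)"
    have sums: "sum h I = M * m" "sum q I = M * s" using M by (auto simp: m_def s_def)
    have sd: "sum d J = sum q J - 2 * m * sum h J + card J * m\<^sup>2" for J
      by (simp add: d_def sum.distrib sum_subtractf sum_distrib_left)
    have sdI: "sum d I = M * (s - m\<^sup>2)"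
      unfolding sd sums by (simp add: M_def algebra_simps power2_eq_square)
    obtain j where j: "j \<in> I" "s - m\<^sup>2 \<le> d j"
    proof (rule ccontr)
      assume "\<not> thesis"
      then have "sum d I < (\<Sum>i\<in>I. s - m\<^sup>2)"
        using that Suc.prems by (intro sum_strict_mono) (auto simp: not_le[symmetric])
      then show False using sdI by (simp add: M_def)
    qed
    define J where "J = I - {j}"
    have J: "finite J" "card J = k" "J \<subseteq> I"
      using Suc j by (auto simp: J_def)
    then have "J \<noteq> {}" using False by auto
    note J = J this
    have split: "sum f I = f j + sum f J" for f :: "'a \<Rightarrow> real"
      unfolding J_def using j Suc.prems by (simp add: sum.remove)
    define k' where "k' = real k"
    define m' where "m' = sum h J / k'"
    define s' where "s' = sum q J / k'"
    have k': "0 < k'" "M = k' + 1" using False M by (auto simp: k'_def)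
    have sums': "sum h J = k' * m'" "sum q J = k' * s'" using k' by (auto simp: m'_def s'_def)
    have "sum d J \<le> k' * (s - m\<^sup>2)"
      using j split[of d] sdI k' by (simp add: algebra_simps)
    then have "k' * (s' - 2 * m * m' + m\<^sup>2) \<le> k' * (s - m\<^sup>2)"
      unfolding sd sums' J(2) by (simp add: k'_def algebra_simps)
    then have "s' - 2 * m * m' + m\<^sup>2 \<le> s - m\<^sup>2" using k' by simp
    \<comment> \<open>Moving the center from \<open>m\<close> to the own mean \<open>m'\<close> of
      the remaining points only lowers their second moment.\<close>
    moreover have "s' - m'\<^sup>2 = s' - 2 * m * m' + m\<^sup>2 - (m' - m)\<^sup>2"
      by (simp add: algebra_simps power2_eq_square)
    ultimately have "s' - m'\<^sup>2 \<le> s - m\<^sup>2" using zero_le_power2[of "m' - m"] by linarith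
    moreover have V: "s - m\<^sup>2 \<le> \<epsilon>\<^sup>2" using Suc.prems by (simp add: s_def m_def M_def)
    ultimately have V': "s' - m'\<^sup>2 \<le> \<epsilon>\<^sup>2" by simp
    have V'0: "m'\<^sup>2 \<le> s'" using moments_nonneg[of J h q] J Suc.prems by (auto simp: m'_def s'_def k'_def)
    have IH: "(\<Sum>i\<in>J. exp (h i) * psi (W\<^sup>2 + \<epsilon>\<^sup>2 - (q i - (h i)\<^sup>2)))
      \<le> k' * (exp m' * psi (W\<^sup>2 + \<epsilon>\<^sup>2 - (s' - m'\<^sup>2)))"
      using Suc.hyps(1)[of J] Suc.hyps(2) Suc.prems J V' by (auto simp: m'_def s'_def k'_def)
    have mm: "m = (1 - 1 / M) * m' + 1 / M * h j"
      and ss: "s = (1 - 1 / M) * s' + 1 / M * q j"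
    proof -
      have w: "1 - 1 / M = k' / M" using k' by (simp add: field_simps)
      have "M * m = h j + k' * m'" "M * s = q j + k' * s'"
        using split[of h] split[of q] unfolding sums sums' by auto
      then show "m = (1 - 1 / M) * m' + 1 / M * h j" "s = (1 - 1 / M) * s' + 1 / M * q j"
        unfolding w using M(1) by (auto simp: field_simps)
    qed
    \<comment> \<open>At least two points are present, so \<open>1 / M\<close> and its complement
      are both at least \<open>1 / N\<close>.\<close>
    have t: "1 / N \<le> 1 / M" "1 / M \<le> 1 - 1 / N"
    proof -
      have "M \<le> N" using Suc.prems by (simp add: M_def)
      then show "1 / N \<le> 1 / M" using M by (simp add: frac_le)
      moreover have "1 / M \<le> 1 - 1 / M" using M False by (simp add: field_simps)
      ultimately show "1 / M \<le> 1 - 1 / N" by simp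
    qed
    have N: "0 < 1 / real N" using Suc by (auto simp: card_gt_0_iff)
    have "(1 - 1 / M) * (exp m' * psi (W\<^sup>2 + \<epsilon>\<^sup>2 - (s' - m'\<^sup>2)))
        + 1 / M * (exp (h j) * psi (W\<^sup>2 + \<epsilon>\<^sup>2 - (q j - (h j)\<^sup>2)))
      \<le> exp ((1 - 1 / M) * m' + 1 / M * h j) * psi (W\<^sup>2 + \<epsilon>\<^sup>2 - (s - m\<^sup>2))"
    proof (rule bellman_two_point[OF N t W \<epsilon> fin _ V' _ _ V])
      show "s - m\<^sup>2 = (1 - 1 / M) * (s' - m'\<^sup>2) + 1 / M * (q j - (h j)\<^sup>2)
          + 1 / M * (1 - 1 / M) * (h j - m')\<^sup>2"
        unfolding mm ss by (simp add: algebra_simps power2_eq_square)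
    qed (use V'0 Suc.prems j in auto)
    then have "M * ((1 - 1 / M) * (exp m' * psi (W\<^sup>2 + \<epsilon>\<^sup>2 - (s' - m'\<^sup>2)))
        + 1 / M * (exp (h j) * psi (W\<^sup>2 + \<epsilon>\<^sup>2 - (q j - (h j)\<^sup>2))))
      \<le> M * (exp m * psi (W\<^sup>2 + \<epsilon>\<^sup>2 - (s - m\<^sup>2)))"
      unfolding mm[symmetric] using M by (intro mult_left_mono) auto
    moreover have "M * ((1 - 1 / M) * X + 1 / M * Y) = (M - 1) * X + Y" for X Y
      using M(1) by (simp add: field_simps)
    moreover have "M - 1 = k'" using k' by simp
    ultimately have "k' * (exp m' * psi (W\<^sup>2 + \<epsilon>\<^sup>2 - (s' - m'\<^sup>2)))
        + exp (h j) * psi (W\<^sup>2 + \<epsilon>\<^sup>2 - (q j - (h j)\<^sup>2))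
      \<le> M * (exp m * psi (W\<^sup>2 + \<epsilon>\<^sup>2 - (s - m\<^sup>2)))" by simp
    with IH show ?thesis
      unfolding split[of "\<lambda>i. exp (h i) * psi (W\<^sup>2 + \<epsilon>\<^sup>2 - (q i - (h i)\<^sup>2))"]
      by (simp add: m_def s_def M_def)
  qed
qed

section \<open>Dyadic cubes\<close>

definition dcube :: "int \<Rightarrow> int ^ 'n \<Rightarrow> (real ^ 'n) set" where
  "dcube k m = box (\<chi> i. of_int (m $ i) * 2 powi k) (\<chi> i. (of_int (m $ i) + 1) * 2 powi k)"

lemma dyadic_cubes_eq: "dyadic_cubes = {dcube k m | k m. True}"
  by (simp add: dyadic_cubes_def dcube_def)

lemma dcube_in_dyadic_cubes [simp]: "dcube k m \<in> dyadic_cubes"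
  by (auto simp: dyadic_cubes_eq)

lemma mem_dcube:
  "x \<in> dcube k m \<longleftrightarrow> (\<forall>i. of_int (m $ i) * 2 powi k < x $ i \<and> x $ i < (of_int (m $ i) + 1) * 2 powi k)"
  by (simp add: dcube_def mem_box_cart)

lemma lmeasurable_dcube [simp]: "dcube k m \<in> lmeasurable"
  by (simp add: dcube_def)

lemma sets_dcube [measurable, simp]: "dcube k m \<in> sets lebesgue"
  by (simp add: dcube_def)

lemma measure_dcube [simp]: "measure lebesgue (dcube k m :: (real ^ 'n) set) = (2 powi k) ^ CARD('n)"
proof -
  let ?a = "(\<chi> i. of_int (m $ i) * 2 powi k) :: real ^ 'n"
  let ?b = "(\<chi> i. (of_int (m $ i) + 1) * 2 powi k) :: real ^ 'n"
  have "measure lebesgue (dcube k m) = measure lborel (box ?a ?b)"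
    unfolding dcube_def by (rule measure_completion) simp
  also have "\<dots> = measure lborel (cbox ?a ?b)"
    by (simp add: measure_lborel_box_eq measure_lborel_cbox_eq)
  also have "\<dots> = (\<Prod>i\<in>(UNIV :: 'n set). ?b $ i - ?a $ i)"
    by (intro content_cbox_cart) (simp add: interval_ne_empty_cart algebra_simps)
  also have "\<dots> = (2 powi k) ^ CARD('n)"
    by (simp add: algebra_simps)
  finally show ?thesis .
qed

lemma emeasure_dcube: "emeasure lebesgue (dcube k m :: (real ^ 'n) set) = ennreal ((2 powi k) ^ CARD('n))"
  using emeasure_eq_measure2[of "dcube k m" lebesgue] lmeasurable_dcube[of k m]
  by (simp add: fmeasurable_def)

text \<open>\<open>A\<close> is the set of coordinates in which the child takes the upper half, so
  the children are indexed by the type \<open>'n set\<close>, whose cardinality is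
  \<open>2 ^ CARD('n)\<close>.\<close>

definition child :: "int ^ 'n \<Rightarrow> 'n set \<Rightarrow> int ^ 'n" where
  "child m A = (\<chi> i. 2 * m $ i + of_bool (i \<in> A))"

lemma powi_double: "2 powi k = 2 * (2 powi (k - 1) :: real)"
  using power_int_add_1[of "2::real" "k - 1"] by simp

lemma dcube_child_subset: "dcube (k - 1) (child m A) \<subseteq> dcube k m"
proof
  fix x assume x: "x \<in> dcube (k - 1) (child m A)"
  define c where "c = (2 powi (k - 1) :: real)"
  have c: "0 < c" by (simp add: c_def)
  have "of_int (m $ i) * (2 * c) < x $ i \<and> x $ i < (of_int (m $ i) + 1) * (2 * c)" for i
    using x c by (cases "i \<in> A")
      (auto simp: mem_dcube child_def c_def[symmetric] algebra_simps dest!: spec[of _ i])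
  then show "x \<in> dcube k m" unfolding mem_dcube powi_double[of k] c_def by blast
qed

lemma dcube_child_disjoint:
  assumes "A \<noteq> B"
  shows "dcube (k - 1) (child m A) \<inter> dcube (k - 1) (child m B) = {}"
proof -
  obtain i where i: "i \<in> A \<longleftrightarrow> i \<notin> B" using assms by blast
  have "False" if "x \<in> dcube (k - 1) (child m A)" "x \<in> dcube (k - 1) (child m B)" for x
    using that i by (auto simp: mem_dcube child_def algebra_simps dest!: spec[of _ i])
  then show ?thesis by blast
qed

lemma negligible_coordinate: "negligible {x :: real ^ 'n. x $ i = c}"
  using negligible_hyperplane[of "axis i 1 :: real ^ 'n" c]
  by (simp add: inner_axis' axis_eq_0_iff)

lemma negligible_dcube_minus_children:
  "negligible (dcube k m - (\<Union>A. dcube (k - 1) (child m A)))"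
proof (rule negligible_subset)
  show "negligible (\<Union>i. {x. x $ i = (of_int (2 * m $ i) + 1) * (2::real) powi (k - 1)})"
    by (intro negligible_Union) (auto intro: negligible_coordinate)
  show "dcube k m - (\<Union>A. dcube (k - 1) (child m A))
      \<subseteq> (\<Union>i. {x. x $ i = (of_int (2 * m $ i) + 1) * 2 powi (k - 1)})"
  proof (rule subsetI, rule ccontr)
    fix x
    assume x: "x \<in> dcube k m - (\<Union>A. dcube (k - 1) (child m A))"
      and ne: "x \<notin> (\<Union>i. {x. x $ i = (of_int (2 * m $ i) + 1) * 2 powi (k - 1)})"
    define A where "A = {i. x $ i > (of_int (2 * m $ i) + 1) * 2 powi (k - 1)}"
    define c where "c = (2 powi (k - 1) :: real)"
    have "of_int (child m A $ i) * c < x $ i \<and> x $ i < (of_int (child m A $ i) + 1) * c" for i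
    proof -
      have "of_int (m $ i) * (2 * c) < x $ i \<and> x $ i < (of_int (m $ i) + 1) * (2 * c)"
        using DiffD1[OF x] unfolding mem_dcube powi_double[of k] c_def by blast
      moreover have "x $ i \<noteq> (of_int (2 * m $ i) + 1) * c" using ne by (auto simp: c_def)
      ultimately show ?thesis
        by (cases "i \<in> A") (auto simp: child_def A_def c_def[symmetric] algebra_simps)
    qed
    then have "x \<in> dcube (k - 1) (child m A)" by (simp add: mem_dcube c_def)
    with x show False by blast
  qed
qed

lemma AE_mem_children:
  "AE x in lebesgue. x \<in> (\<Union>A. dcube (k - 1) (child m A)) \<longleftrightarrow> x \<in> dcube k m"
proof (rule AE_I')
  show "dcube k m - (\<Union>A. dcube (k - 1) (child m A)) \<in> null_sets lebesgue"
    using negligible_dcube_minus_children[of k m] by (simp add: negligible_iff_null_sets)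
  show "{x \<in> space lebesgue. (x \<in> (\<Union>A. dcube (k - 1) (child m A))) \<noteq> (x \<in> dcube k m)}
      \<subseteq> dcube k m - (\<Union>A. dcube (k - 1) (child m A))"
    using dcube_child_subset[of k m] by auto
qed

lemma
  fixes f :: "real ^ 'n \<Rightarrow> real"
  assumes int: "\<And>A. set_integrable lebesgue (dcube (k - 1) (child m A)) f"
  shows set_integrable_dcube_children: "set_integrable lebesgue (dcube k m) f"
    and set_integral_dcube_children:
      "(LINT x:dcube k m|lebesgue. f x) = (\<Sum>A\<in>UNIV. LINT x:dcube (k - 1) (child m A)|lebesgue. f x)"
proof -
  let ?U = "\<Union>A\<in>UNIV. dcube (k - 1) (child m A)"
  have U: "set_integrable lebesgue ?U f"
    by (intro set_integrable_UN) (auto intro: int)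
  show Q: "set_integrable lebesgue (dcube k m) f"
  proof (rule absolutely_integrable_spike_set[OF U])
    have "{x \<in> ?U - dcube k m. f x \<noteq> 0} = {}" using dcube_child_subset[of k m] by blast
    then show "negligible {x \<in> ?U - dcube k m. f x \<noteq> 0}" by (simp only: negligible_empty)
    show "negligible {x \<in> dcube k m - ?U. f x \<noteq> 0}"
      by (rule negligible_subset[OF negligible_dcube_minus_children[of k m]]) auto
  qed
  have "(LINT x:dcube k m|lebesgue. f x) = (LINT x:?U|lebesgue. f x)"
    using U Q AE_mem_children[of k m]
    by (intro set_integral_cong_set) (auto simp: set_borel_measurable_def set_integrable_def)
  also have "\<dots> = (\<Sum>A\<in>UNIV. LINT x:dcube (k - 1) (child m A)|lebesgue. f x)"
    by (intro set_integral_finite_Union int)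
      (auto simp: disjoint_family_on_def dcube_child_disjoint)
  finally show "(LINT x:dcube k m|lebesgue. f x) = (\<Sum>A\<in>UNIV. LINT x:dcube (k - 1) (child m A)|lebesgue. f x)" .
qed

lemma avg_dcube_children:
  fixes f :: "real ^ 'n \<Rightarrow> real"
  assumes "set_integrable lebesgue (dcube k m) f"
  shows "avg (dcube k m) f = (\<Sum>A\<in>UNIV. avg (dcube (k - 1) (child m A)) f) / CARD('n set)"
proof -
  have int: "set_integrable lebesgue (dcube (k - 1) (child m A)) f" for A
    by (rule set_integrable_subset[OF assms]) (auto simp: dcube_child_subset)
  show ?thesis
    by (simp add: avg_def set_integral_dcube_children[OF int] powi_double[of k] power_mult_distrib
        card_UNIV_set flip: sum_divide_distrib)
qed

text \<open>Composition with \<open>corner l\<close> makes a function constant on each cube of side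
  \<open>2 powi l\<close>; for continuous functions these step functions converge pointwise as the
  side shrinks.\<close>

definition corner :: "int \<Rightarrow> real ^ 'n \<Rightarrow> real ^ 'n" where
  "corner l x = (\<chi> i. of_int \<lfloor>x $ i / 2 powi l\<rfloor> * 2 powi l)"

lemma corner_dcube:
  assumes "x \<in> dcube l m"
  shows "corner l x = (\<chi> i. of_int (m $ i) * 2 powi l)"
proof -
  have "\<lfloor>x $ i / 2 powi l\<rfloor> = m $ i" for i
    using assms by (intro floor_unique) (auto simp: mem_dcube field_simps intro: less_imp_le)
  then show ?thesis by (simp add: corner_def)
qed

lemma corner_tendsto: "(\<lambda>j. corner (k - int j) x) \<longlonglongrightarrow> x"
proof (rule vec_tendstoI)
  fix i
  have eq: "(2::real) powi (k - int j) = 2 powi k * (1 / 2) ^ j" for j :: nat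
    by (simp add: power_int_diff power_divide)
  have "(\<lambda>j. x $ i - 2 powi k * (1 / 2) ^ j) \<longlonglongrightarrow> x $ i - 2 powi k * 0"
    by (intro tendsto_intros LIMSEQ_power_zero) auto
  then have lower: "(\<lambda>j. x $ i - 2 powi (k - int j)) \<longlonglongrightarrow> x $ i" unfolding eq by simp
  have *: "x $ i - 2 powi (k - int j) \<le> corner (k - int j) x $ i" "corner (k - int j) x $ i \<le> x $ i" for j
  proof -
    define c where "c = (2 powi (k - int j) :: real)"
    have c: "0 < c" by (simp add: c_def)
    have "(x $ i / c - 1) * c \<le> of_int \<lfloor>x $ i / c\<rfloor> * c" "of_int \<lfloor>x $ i / c\<rfloor> * c \<le> x $ i / c * c"
      using c by (intro mult_right_mono; linarith)+
    then show "x $ i - 2 powi (k - int j) \<le> corner (k - int j) x $ i" "corner (k - int j) x $ i \<le> x $ i"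
      using c by (simp_all add: corner_def c_def[symmetric] algebra_simps)
  qed
  show "(\<lambda>j. corner (k - int j) x $ i) \<longlonglongrightarrow> x $ i"
    by (rule tendsto_sandwich[OF _ _ lower tendsto_const]) (simp_all add: *)
qed

section \<open>The upper bound\<close>

lemma exp_tangent_le: "exp s * (1 + t - s) \<le> exp (t::real)"
proof -
  have "exp s * (1 + (t - s)) \<le> exp s * exp (t - s)" by (intro mult_left_mono) auto
  then show ?thesis by (simp add: add_diff_eq flip: exp_add)
qed

text \<open>Supplies the dominating function for two limits. The points of tangency are bounded only
  from above; for very negative \<open>s\<close> the factor \<open>exp s\<close> outweighs
  \<open>\<bar>s\<bar>\<close>.\<close>

lemma abs_exp_tangent_le:
  fixes s t M :: real
  assumes "s \<le> M" "0 \<le> M"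
  shows "\<bar>exp s * (1 + t - s)\<bar> \<le> exp M * (1 + \<bar>t\<bar>) + 1 + M * exp M"
proof -
  have "exp s * \<bar>s\<bar> \<le> 1 + M * exp M"
  proof (cases "0 \<le> s")
    case True
    then have "exp s * \<bar>s\<bar> \<le> exp M * M" using assms by (intro mult_mono) auto
    then show ?thesis by (simp add: mult.commute)
  next
    case False
    then have "exp s * \<bar>s\<bar> \<le> exp s * exp (- s)"
      using exp_ge_add_one_self[of "- s"] by (intro mult_left_mono) auto
    then have "exp s * \<bar>s\<bar> \<le> 1" by (simp flip: exp_add)
    then show ?thesis using assms by (simp add: add_increasing2)
  qed
  moreover have "exp s * (1 + \<bar>t\<bar>) \<le> exp M * (1 + \<bar>t\<bar>)"
    using assms by (intro mult_right_mono) auto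
  moreover have "\<bar>exp s * (1 + t - s)\<bar> \<le> exp s * (1 + \<bar>t\<bar>) + exp s * \<bar>s\<bar>"
    by (simp add: abs_mult flip: distrib_left)
  ultimately show ?thesis by linarith
qed

text \<open>The integral of \<open>exp \<circ> \<phi>\<close> is recovered from its tangent-line minorants
  \<open>exp s * (1 + \<phi> - s)\<close>; continuous \<open>s\<close> suffice, since a
  measurable function is an almost everywhere limit of continuous ones.\<close>

lemma nn_integral_exp_le:
  fixes \<phi> :: "'a::euclidean_space \<Rightarrow> real"
  assumes Q: "Q \<in> lmeasurable" and \<phi>: "set_integrable lebesgue Q \<phi>"
    and bound: "\<And>s M. continuous_on UNIV s \<Longrightarrow> 0 \<le> M \<Longrightarrow> (\<And>x. s x \<le> M) \<Longrightarrow>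
      (LINT x:Q|lebesgue. exp (s x) * (1 + \<phi> x - s x)) \<le> K"
  shows "set_nn_integral lebesgue Q (\<lambda>x. ennreal (exp (\<phi> x))) \<le> ennreal K"
proof -
  define u where "u = (\<lambda>x. indicator Q x * \<phi> x)"
  have u: "integrable lebesgue u" using \<phi> by (simp add: u_def set_integrable_def)
  then have um [measurable]: "u \<in> borel_measurable lebesgue" by simp
  have Qm [measurable]: "Q \<in> sets lebesgue" using Q by (simp add: fmeasurableD)
  have Qi: "integrable lebesgue (\<lambda>x. indicator Q x * c)" for c :: real
    using Q by (simp add: fmeasurable_def)
  obtain N g where N: "negligible N" and g: "\<And>n. continuous_on UNIV (g n)"
    and lim: "\<And>x. x \<notin> N \<Longrightarrow> (\<lambda>n. g n x) \<longlonglongrightarrow> u x"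
    using lebesgue_measurable_imp_measurable_on_real[OF um, of UNIV]
    unfolding measurable_on_def by auto
  have gm [measurable]: "g n \<in> borel_measurable lebesgue" for n
    using borel_measurable_continuous_onI[OF g[of n]] by (intro measurable_completion) simp
  have AEN: "AE x in lebesgue. x \<notin> N"
    using N by (intro AE_I'[of N]) (auto simp: negligible_iff_null_sets)
  \<comment> \<open>Truncation at \<open>M\<close> keeps the points of tangency bounded above, as
    \<open>bound\<close> and dominated convergence demand; Fatou's lemma removes it
    afterwards.\<close>
  have trunc: "(\<integral>\<^sup>+x. ennreal (indicator Q x * exp (min (u x) M)) \<partial>lebesgue) \<le> ennreal K"
    if M: "0 \<le> M" for M
  proof -
    define F where "F = (\<lambda>n x. indicator Q x * (exp (min (g n x) M) * (1 + u x - min (g n x) M)))"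
    define G where "G = (\<lambda>x. indicator Q x * (exp (min (u x) M) * (1 + u x - min (u x) M)))"
    define w where "w = (\<lambda>x. exp M * \<bar>u x\<bar> + indicator Q x * (exp M + 1 + M * exp M))"
    have meas: "G \<in> borel_measurable lebesgue" "\<And>n. F n \<in> borel_measurable lebesgue"
      unfolding G_def F_def by measurable
    have w: "integrable lebesgue w" unfolding w_def using u Qi by auto
    have dom: "AE x in lebesgue. norm (F n x) \<le> w x" for n
    proof (rule AE_I2)
      fix x
      have "\<bar>exp (min (g n x) M) * (1 + u x - min (g n x) M)\<bar> \<le> exp M * (1 + \<bar>u x\<bar>) + 1 + M * exp M"
        using M by (intro abs_exp_tangent_le) auto
      then show "norm (F n x) \<le> w x"
        by (cases "x \<in> Q") (auto simp: F_def w_def algebra_simps)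
    qed
    have conv: "AE x in lebesgue. (\<lambda>n. F n x) \<longlonglongrightarrow> G x"
      using AEN
    proof eventually_elim
      case (elim x)
      then show ?case unfolding F_def G_def by (intro tendsto_intros lim)
    qed
    have G: "integrable lebesgue G" "(\<lambda>n. integral\<^sup>L lebesgue (F n)) \<longlonglongrightarrow> integral\<^sup>L lebesgue G"
      using integrable_dominated_convergence[OF meas w conv dom]
        integral_dominated_convergence[OF meas w conv dom] by auto
    have "integral\<^sup>L lebesgue (F n) \<le> K" for n
    proof -
      have "integral\<^sup>L lebesgue (F n)
          = (LINT x:Q|lebesgue. exp (min (g n x) M) * (1 + \<phi> x - min (g n x) M))"
        unfolding set_lebesgue_integral_def
        by (intro Bochner_Integration.integral_cong) (auto simp: F_def u_def indicator_def)
      also have "\<dots> \<le> K"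
        by (intro bound[of _ M] continuous_intros g M) auto
      finally show ?thesis .
    qed
    then have "integral\<^sup>L lebesgue G \<le> K" by (intro LIMSEQ_le_const2[OF G(2)]) auto
    \<comment> \<open>Where \<open>u x > M\<close>, the tangent at \<open>M\<close> no longer
      touches the exponential at \<open>u x\<close> but is still at least
      \<open>exp M\<close>.\<close>
    have Gge: "indicator Q x * exp (min (u x) M) \<le> G x" for x
    proof -
      have "exp (min (u x) M) * 1 \<le> exp (min (u x) M) * (1 + u x - min (u x) M)"
        by (intro mult_left_mono) auto
      then show ?thesis by (auto simp: G_def indicator_def)
    qed
    have "(\<integral>\<^sup>+x. ennreal (indicator Q x * exp (min (u x) M)) \<partial>lebesgue) \<le> (\<integral>\<^sup>+x. ennreal (G x) \<partial>lebesgue)"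
      by (intro nn_integral_mono ennreal_leI Gge)
    also have "\<dots> = ennreal (integral\<^sup>L lebesgue G)"
      using G(1) order_trans[OF _ Gge] by (intro nn_integral_eq_integral) auto
    finally show ?thesis using \<open>integral\<^sup>L lebesgue G \<le> K\<close> by (meson ennreal_leI order_trans)
  qed
  have "set_nn_integral lebesgue Q (\<lambda>x. ennreal (exp (\<phi> x)))
    = (\<integral>\<^sup>+x. liminf (\<lambda>i. ennreal (indicator Q x * exp (min (u x) (real i)))) \<partial>lebesgue)"
  proof (rule nn_integral_cong)
    fix x
    have "eventually (\<lambda>i. ennreal (indicator Q x * exp (min (u x) (real i))) = ennreal (exp (\<phi> x)) * indicator Q x) sequentially"
      using eventually_ge_at_top[of "nat \<lceil>u x\<rceil>"]
    proof eventually_elim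
      case (elim i)
      then have "u x \<le> real i" by linarith
      then show ?case by (auto simp: u_def indicator_def min_def)
    qed
    then have "(\<lambda>i. ennreal (indicator Q x * exp (min (u x) (real i)))) \<longlonglongrightarrow> ennreal (exp (\<phi> x)) * indicator Q x"
      by (rule tendsto_eventually)
    then show "ennreal (exp (\<phi> x)) * indicator Q x
        = liminf (\<lambda>i. ennreal (indicator Q x * exp (min (u x) (real i))))"
      by (simp add: lim_imp_Liminf)
  qed
  also have "\<dots> \<le> liminf (\<lambda>i. \<integral>\<^sup>+x. ennreal (indicator Q x * exp (min (u x) (real i))) \<partial>lebesgue)"
    by (intro nn_integral_liminf) measurable
  also have "\<dots> \<le> ennreal K"
    using trunc by (intro Liminf_le) (auto intro: always_eventually)
  finally show ?thesis .
qed

lemma ennreal_sqrt_le_iff: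
  assumes "0 \<le> \<epsilon>"
  shows "ennreal_sqrt x \<le> ennreal \<epsilon> \<longleftrightarrow> x \<le> ennreal (\<epsilon>\<^sup>2)"
proof (cases x)
  case (real r)
  then show ?thesis using assms
    by (simp add: ennreal_sqrt_def real_le_lsqrt sqrt_le_D) (metis real_sqrt_le_iff real_sqrt_abs abs_of_nonneg)
qed (simp add: ennreal_sqrt_def top_unique)

lemma set_integrable_dcube:
  assumes "locally_integrable \<phi>"
  shows "set_integrable lebesgue (dcube k m) \<phi>"
proof (rule set_integrable_subset)
  let ?K = "cbox (\<chi> i. of_int (m $ i) * 2 powi k) (\<chi> i. (of_int (m $ i) + 1) * 2 powi k)"
  show "set_integrable lebesgue ?K \<phi>" using assms by (simp add: locally_integrable_def)
  show "dcube k m \<subseteq> ?K" unfolding dcube_def by (rule box_subset_cbox)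
qed simp

lemma avg_dcube_linear:
  fixes \<phi> :: "real ^ 'n \<Rightarrow> real"
  assumes "set_integrable lebesgue (dcube k m) \<phi>"
  shows "set_integrable lebesgue (dcube k m) (\<lambda>x. a + b * \<phi> x)"
    and "avg (dcube k m) (\<lambda>x. a + b * \<phi> x) = a + b * avg (dcube k m) \<phi>"
proof -
  have const: "set_integrable lebesgue (dcube k m) (\<lambda>x. a)"
    using emeasure_dcube[of k m] by (simp add: set_integrable_def)
  then show int: "set_integrable lebesgue (dcube k m) (\<lambda>x. a + b * \<phi> x)"
    using assms by (intro set_integral_add) auto
  have "(LINT x:dcube k m|lebesgue. a + b * \<phi> x) = measure lebesgue (dcube k m) * a + b * (LINT x:dcube k m|lebesgue. \<phi> x)"
    using assms const by (subst set_integral_add) (auto simp: set_lebesgue_integral_def simp del: measure_dcube)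
  then show "avg (dcube k m) (\<lambda>x. a + b * \<phi> x) = a + b * avg (dcube k m) \<phi>"
    by (simp add: avg_def add_divide_distrib)
qed

text \<open>Passes from the extended-real definition to real moments: the finite integral of the
  squared deviation yields integrability of the square by expansion around the mean.\<close>

lemma BMO_ball_dcube:
  fixes \<phi> :: "real ^ 'n \<Rightarrow> real" and k :: int and m :: "int ^ 'n"
  assumes \<phi>: "\<phi> \<in> BMO_ball \<epsilon>" and \<epsilon>: "0 \<le> \<epsilon>"
  defines "Q \<equiv> dcube k m"
  shows "set_integrable lebesgue Q \<phi>"
    and "set_integrable lebesgue Q (\<lambda>x. (\<phi> x)\<^sup>2)"
    and "(avg Q \<phi>)\<^sup>2 \<le> avg Q (\<lambda>x. (\<phi> x)\<^sup>2)"
    and "avg Q (\<lambda>x. (\<phi> x)\<^sup>2) - (avg Q \<phi>)\<^sup>2 \<le> \<epsilon>\<^sup>2"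
proof -
  show int: "set_integrable lebesgue Q \<phi>"
    using \<phi> set_integrable_dcube by (auto simp: Q_def BMO_ball_def BMO_def)
  define a where "a = avg Q \<phi>"
  define P where "P = (2 powi k :: real) ^ CARD('n)"
  have P: "0 < P" "emeasure lebesgue Q = ennreal P" "measure lebesgue Q = P"
    by (simp_all add: P_def Q_def emeasure_dcube)
  have "ennreal_sqrt (nn_avg Q (\<lambda>x. ennreal (\<bar>\<phi> x - a\<bar>\<^sup>2))) \<le> bmo_norm \<phi>"
    unfolding bmo_norm_def a_def Q_def by (intro SUP_upper) simp
  also have "\<dots> \<le> ennreal \<epsilon>" using \<phi> by (simp add: BMO_ball_def)
  finally have "nn_avg Q (\<lambda>x. ennreal ((\<phi> x - a)\<^sup>2)) \<le> ennreal (\<epsilon>\<^sup>2)"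
    using \<epsilon> by (simp add: ennreal_sqrt_le_iff)
  then have "(\<integral>\<^sup>+x. ennreal ((\<phi> x - a)\<^sup>2) * indicator Q x \<partial>lebesgue) / ennreal P * ennreal P
      \<le> ennreal (\<epsilon>\<^sup>2) * ennreal P"
    unfolding nn_avg_def P(2) by (rule mult_right_mono) simp
  also have "ennreal (\<epsilon>\<^sup>2) * ennreal P = ennreal (\<epsilon>\<^sup>2 * P)" using P by (simp add: ennreal_mult)
  finally have "(\<integral>\<^sup>+x. ennreal ((\<phi> x - a)\<^sup>2) * indicator Q x \<partial>lebesgue) \<le> ennreal (\<epsilon>\<^sup>2 * P)"
    using P by (simp add: ennreal_divide_times mult_divide_eq_ennreal)
  then have le: "(\<integral>\<^sup>+x. ennreal (indicator Q x * (\<phi> x - a)\<^sup>2) \<partial>lebesgue) \<le> ennreal (\<epsilon>\<^sup>2 * P)"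
    by (simp add: indicator_mult_ennreal mult.commute)
  have "(\<lambda>x. indicator Q x * (\<phi> x - a)\<^sup>2) = (\<lambda>x. (indicator Q x * \<phi> x - indicator Q x * a)\<^sup>2)"
    by (auto simp: indicator_def)
  moreover have "(\<lambda>x. (indicator Q x * \<phi> x - indicator Q x * a)\<^sup>2) \<in> borel_measurable lebesgue"
    using int unfolding set_integrable_def Q_def
    by (intro borel_measurable_power borel_measurable_diff) auto
  ultimately have "(\<lambda>x. indicator Q x * (\<phi> x - a)\<^sup>2) \<in> borel_measurable lebesgue" by simp
  then have dev: "integrable lebesgue (\<lambda>x. indicator Q x * (\<phi> x - a)\<^sup>2)"
    using le by (intro integrableI_nonneg) (auto intro: le_less_trans)
  then have dev': "set_integrable lebesgue Q (\<lambda>x. (\<phi> x - a)\<^sup>2)"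
    by (simp add: set_integrable_def)
  have sq: "(\<phi> x)\<^sup>2 = (- a\<^sup>2 + 2 * a * \<phi> x) + (\<phi> x - a)\<^sup>2" for x
    by (simp add: power2_eq_square algebra_simps)
  have lin: "set_integrable lebesgue Q (\<lambda>x. - a\<^sup>2 + 2 * a * \<phi> x)"
    "avg Q (\<lambda>x. - a\<^sup>2 + 2 * a * \<phi> x) = - a\<^sup>2 + 2 * a * a"
    using avg_dcube_linear[of k m \<phi> "- a\<^sup>2" "2 * a"] int by (auto simp: Q_def a_def)
  show "set_integrable lebesgue Q (\<lambda>x. (\<phi> x)\<^sup>2)"
    unfolding sq by (intro set_integral_add(1) lin dev')
  have "avg Q (\<lambda>x. (\<phi> x)\<^sup>2) = avg Q (\<lambda>x. - a\<^sup>2 + 2 * a * \<phi> x) + avg Q (\<lambda>x. (\<phi> x - a)\<^sup>2)"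
    unfolding sq avg_def set_integral_add(2)[OF lin(1) dev'] by (rule add_divide_distrib)
  then have eq: "avg Q (\<lambda>x. (\<phi> x)\<^sup>2) - a\<^sup>2 = avg Q (\<lambda>x. (\<phi> x - a)\<^sup>2)"
    unfolding lin(2) by (simp add: power2_eq_square)
  have nn: "0 \<le> (LINT x:Q|lebesgue. (\<phi> x - a)\<^sup>2)"
    unfolding set_lebesgue_integral_def by (intro integral_nonneg_AE) auto
  have "ennreal (LINT x:Q|lebesgue. (\<phi> x - a)\<^sup>2) \<le> ennreal (\<epsilon>\<^sup>2 * P)"
    using le nn_integral_eq_integral[OF dev] by (simp add: set_lebesgue_integral_def)
  then have "(LINT x:Q|lebesgue. (\<phi> x - a)\<^sup>2) \<le> \<epsilon>\<^sup>2 * P"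
    using P by (simp add: ennreal_le_iff)
  then have "avg Q (\<lambda>x. (\<phi> x - a)\<^sup>2) \<le> \<epsilon>\<^sup>2" using P by (simp add: avg_def field_simps)
  then show "avg Q (\<lambda>x. (\<phi> x)\<^sup>2) - (avg Q \<phi>)\<^sup>2 \<le> \<epsilon>\<^sup>2" using eq by (simp add: a_def)
  show "(avg Q \<phi>)\<^sup>2 \<le> avg Q (\<lambda>x. (\<phi> x)\<^sup>2)"
  proof -
    have "0 \<le> avg Q (\<lambda>x. (\<phi> x - a)\<^sup>2)" using nn P by (simp add: avg_def)
    then show ?thesis using eq by (simp add: a_def)
  qed
qed

section \<open>Induction over dyadic generations\<close>

text \<open>The scale at which \<open>s\<close> is sampled lies \<open>j\<close> generations below
  the cube. At depth 0 the sampled \<open>s\<close> is constant on the cube, so the integrand is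
  affine in \<phi> and its mean is explicit; each further depth is one application of the main
  inequality.\<close>

lemma bellman_dyadic_bound:
  fixes \<phi> s :: "real ^ 'n \<Rightarrow> real" and W \<epsilon> :: real
  assumes \<phi>: "\<phi> \<in> BMO_ball \<epsilon>" and \<epsilon>: "0 \<le> \<epsilon>" and W: "0 \<le> W" "W\<^sup>2 + \<epsilon>\<^sup>2 < 1"
    and fin: "0 \<le> gap (1 / real CARD('n set)) (W\<^sup>2 + \<epsilon>\<^sup>2) (W\<^sup>2) (W\<^sup>2) (\<epsilon> / sqrt (1 / real CARD('n set)))"
  defines "f \<equiv> \<lambda>l x. exp (s (corner l x)) * (1 + \<phi> x - s (corner l x))"
  shows "set_integrable lebesgue (dcube k m) (f (k - int j)) \<and>
    (LINT x:dcube k m|lebesgue. f (k - int j) x) * psi (W\<^sup>2 + \<epsilon>\<^sup>2)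
      \<le> measure lebesgue (dcube k m) * (exp (avg (dcube k m) \<phi>) *
          psi (W\<^sup>2 + \<epsilon>\<^sup>2 - (avg (dcube k m) (\<lambda>x. (\<phi> x)\<^sup>2) - (avg (dcube k m) \<phi>)\<^sup>2)))"
proof (induction j arbitrary: k m)
  case 0
  let ?Q = "dcube k m"
  define c where "c = s (\<chi> i. of_int (m $ i) * 2 powi k)"
  define P where "P = measure lebesgue ?Q"
  have P: "0 < P" by (simp add: P_def)
  note bmo = BMO_ball_dcube[OF \<phi> \<epsilon>, of k m]
  define L where "L = (\<lambda>x. exp c * (1 - c) + exp c * \<phi> x)"
  have fL: "f k x = L x" if "x \<in> ?Q" for x
    using that by (simp add: f_def L_def corner_dcube c_def algebra_simps)
  have L: "set_integrable lebesgue ?Q L" "avg ?Q L = exp c * (1 + avg ?Q \<phi> - c)"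
    unfolding L_def avg_dcube_linear(2)[OF bmo(1)]
    by (auto simp: algebra_simps intro!: avg_dcube_linear(1) bmo)
  have "set_integrable lebesgue ?Q (f k) \<longleftrightarrow> set_integrable lebesgue ?Q L"
    by (intro set_integrable_cong) (auto simp: fL)
  then have int: "set_integrable lebesgue ?Q (f k)" using L by simp
  have "(LINT x:?Q|lebesgue. f k x) = (LINT x:?Q|lebesgue. L x)"
    by (intro set_lebesgue_integral_cong) (auto simp: fL)
  also have "\<dots> = P * avg ?Q L" using P unfolding avg_def P_def by simp
  \<comment> \<open>The tangent inequality is applied at the mean; inserting the variance afterwards
    can only enlarge the \<open>psi\<close> factor.\<close>
  also have "\<dots> \<le> P * exp (avg ?Q \<phi>)"
    unfolding L by (intro mult_left_mono exp_tangent_le) (use P in auto)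
  finally have "(LINT x:?Q|lebesgue. f k x) * psi (W\<^sup>2 + \<epsilon>\<^sup>2) \<le> P * exp (avg ?Q \<phi>) * psi (W\<^sup>2 + \<epsilon>\<^sup>2)"
    using psi_pos[OF W(2)] by (intro mult_right_mono) auto
  also have "\<dots> \<le> P * exp (avg ?Q \<phi>) * psi (W\<^sup>2 + \<epsilon>\<^sup>2 - (avg ?Q (\<lambda>x. (\<phi> x)\<^sup>2) - (avg ?Q \<phi>)\<^sup>2))"
    using bmo(3,4) P by (intro mult_left_mono psi_antimono) (auto simp: algebra_simps intro: add_increasing)
  finally show ?case using int by (simp add: P_def mult_ac)
next
  case (Suc j)
  let ?Q = "dcube k m"
  define ch where "ch = (\<lambda>A. dcube (k - 1) (child m A))"
  define c where "c = (2 powi (k - 1) :: real) ^ CARD('n)"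
  have c: "0 < c" "measure lebesgue (ch A) = c" for A by (simp_all add: c_def ch_def)
  have cQ: "measure lebesgue ?Q = c * CARD('n set)"
    by (simp add: c_def powi_double[of k] power_mult_distrib card_UNIV_set)
  \<comment> \<open>Depth \<open>j\<close> below a child and depth \<open>Suc j\<close> below the
    parent are the same sampling scale.\<close>
  have lev: "k - 1 - int j = k - int (Suc j)" by simp
  define h where "h = (\<lambda>A. avg (ch A) \<phi>)"
  define q where "q = (\<lambda>A. avg (ch A) (\<lambda>x. (\<phi> x)\<^sup>2))"
  note bmo = BMO_ball_dcube[OF \<phi> \<epsilon>, of k m]
  have hQ: "avg ?Q \<phi> = sum h UNIV / CARD('n set)" and qQ: "avg ?Q (\<lambda>x. (\<phi> x)\<^sup>2) = sum q UNIV / CARD('n set)"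
    unfolding h_def q_def ch_def by (intro avg_dcube_children bmo)+
  have IH: "set_integrable lebesgue (ch A) (f (k - int (Suc j)))"
    "(LINT x:ch A|lebesgue. f (k - int (Suc j)) x) * psi (W\<^sup>2 + \<epsilon>\<^sup>2)
      \<le> c * (exp (h A) * psi (W\<^sup>2 + \<epsilon>\<^sup>2 - (q A - (h A)\<^sup>2)))" for A
  proof -
    have "dcube (k - 1) (child m A) = ch A" by (simp add: ch_def)
    then show "set_integrable lebesgue (ch A) (f (k - int (Suc j)))"
      "(LINT x:ch A|lebesgue. f (k - int (Suc j)) x) * psi (W\<^sup>2 + \<epsilon>\<^sup>2)
        \<le> c * (exp (h A) * psi (W\<^sup>2 + \<epsilon>\<^sup>2 - (q A - (h A)\<^sup>2)))"
      using Suc.IH[of "k - 1" "child m A"] unfolding lev h_def q_def by (metis c(2))+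
  qed
  have int: "set_integrable lebesgue ?Q (f (k - int (Suc j)))"
    by (rule set_integrable_dcube_children) (use IH(1) in \<open>simp add: ch_def\<close>)
  have "(LINT x:?Q|lebesgue. f (k - int (Suc j)) x) = (\<Sum>A\<in>UNIV. LINT x:ch A|lebesgue. f (k - int (Suc j)) x)"
    unfolding ch_def by (rule set_integral_dcube_children) (use IH(1) in \<open>simp add: ch_def\<close>)
  then have "(LINT x:?Q|lebesgue. f (k - int (Suc j)) x) * psi (W\<^sup>2 + \<epsilon>\<^sup>2)
      = (\<Sum>A\<in>UNIV. (LINT x:ch A|lebesgue. f (k - int (Suc j)) x) * psi (W\<^sup>2 + \<epsilon>\<^sup>2))"
    by (simp add: sum_distrib_right)
  also have "\<dots> \<le> (\<Sum>A\<in>UNIV. c * (exp (h A) * psi (W\<^sup>2 + \<epsilon>\<^sup>2 - (q A - (h A)\<^sup>2))))"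
    by (intro sum_mono IH)
  also have "\<dots> = c * (\<Sum>A\<in>UNIV. exp (h A) * psi (W\<^sup>2 + \<epsilon>\<^sup>2 - (q A - (h A)\<^sup>2)))"
    by (simp add: sum_distrib_left)
  also have "\<dots> \<le> c * (CARD('n set) * (exp (avg ?Q \<phi>) *
      psi (W\<^sup>2 + \<epsilon>\<^sup>2 - (avg ?Q (\<lambda>x. (\<phi> x)\<^sup>2) - (avg ?Q \<phi>)\<^sup>2))))"
    unfolding hQ qQ
  proof (intro mult_left_mono bellman_main_inequality[OF W \<epsilon> fin])
    show "(h A)\<^sup>2 \<le> q A" "q A - (h A)\<^sup>2 \<le> \<epsilon>\<^sup>2" for A
      unfolding h_def q_def ch_def by (intro BMO_ball_dcube[OF \<phi> \<epsilon>])+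
    show "sum q UNIV / CARD('n set) - (sum h UNIV / CARD('n set))\<^sup>2 \<le> \<epsilon>\<^sup>2"
      using bmo(4) unfolding hQ qQ .
  qed (use c in auto)
  finally show ?case using int unfolding cQ by (simp add: mult_ac)
qed

lemma exp_integral_bound:
  fixes \<phi> :: "real ^ 'n \<Rightarrow> real" and W \<epsilon> :: real
  assumes \<phi>: "\<phi> \<in> BMO_ball \<epsilon>" and \<epsilon>: "0 \<le> \<epsilon>" and W: "0 \<le> W" "W\<^sup>2 + \<epsilon>\<^sup>2 < 1"
    and fin: "0 \<le> gap (1 / real CARD('n set)) (W\<^sup>2 + \<epsilon>\<^sup>2) (W\<^sup>2) (W\<^sup>2) (\<epsilon> / sqrt (1 / real CARD('n set)))"
    and Q: "Q \<in> dyadic_cubes"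
  shows "nn_avg Q (\<lambda>x. ennreal (exp (\<phi> x))) \<le> ennreal (psi (W\<^sup>2) / psi (W\<^sup>2 + \<epsilon>\<^sup>2) * exp (avg Q \<phi>))"
proof -
  obtain k m where Qkm: "Q = dcube k m" using Q by (auto simp: dyadic_cubes_eq)
  define P where "P = measure lebesgue Q"
  have P: "0 < P" "emeasure lebesgue Q = ennreal P" by (simp_all add: P_def Qkm emeasure_dcube)
  note bmo = BMO_ball_dcube[OF \<phi> \<epsilon>, of k m, folded Qkm]
  have psi0: "0 < psi (W\<^sup>2 + \<epsilon>\<^sup>2)" by (rule psi_pos[OF W(2)])
  define K where "K = P * (psi (W\<^sup>2) / psi (W\<^sup>2 + \<epsilon>\<^sup>2) * exp (avg Q \<phi>))"
  have step: "(LINT x:Q|lebesgue. exp (s (corner (k - int j) x)) * (1 + \<phi> x - s (corner (k - int j) x))) \<le> K"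
    for s j
  proof -
    have "(LINT x:Q|lebesgue. exp (s (corner (k - int j) x)) * (1 + \<phi> x - s (corner (k - int j) x))) * psi (W\<^sup>2 + \<epsilon>\<^sup>2)
      \<le> P * (exp (avg Q \<phi>) * psi (W\<^sup>2 + \<epsilon>\<^sup>2 - (avg Q (\<lambda>x. (\<phi> x)\<^sup>2) - (avg Q \<phi>)\<^sup>2)))"
      using bellman_dyadic_bound[OF \<phi> \<epsilon> W fin, of k m s j] by (simp add: Qkm P_def)
    \<comment> \<open>The variance is replaced by its worst value
      \<open>\<epsilon>\<^sup>2\<close>.\<close>
    also have "\<dots> \<le> P * (exp (avg Q \<phi>) * psi (W\<^sup>2))"
      using P bmo by (intro mult_left_mono psi_antimono) auto
    finally show ?thesis using psi0 by (simp add: K_def field_simps)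
  qed
  have "set_nn_integral lebesgue Q (\<lambda>x. ennreal (exp (\<phi> x))) \<le> ennreal K"
  proof (rule nn_integral_exp_le)
    show "Q \<in> lmeasurable" by (simp add: Qkm)
    show "set_integrable lebesgue Q \<phi>" by (rule bmo)
    fix s :: "real ^ 'n \<Rightarrow> real" and M :: real
    assume s: "continuous_on UNIV s" "0 \<le> M" "\<And>x. s x \<le> M"
    define F where "F = (\<lambda>j x. indicator Q x * (exp (s (corner (k - int j) x)) * (1 + \<phi> x - s (corner (k - int j) x))))"
    define G where "G = (\<lambda>x. indicator Q x * (exp (s x) * (1 + \<phi> x - s x)))"
    define w where "w = (\<lambda>x. indicator Q x * (exp M + 1 + M * exp M + exp M * \<bar>\<phi> x\<bar>))"
    have Fm: "F j \<in> borel_measurable lebesgue" for j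
      using bellman_dyadic_bound[OF \<phi> \<epsilon> W fin, of k m s j]
      by (simp add: F_def Qkm set_integrable_def borel_measurable_integrable)
    have conv: "(\<lambda>j. F j x) \<longlonglongrightarrow> G x" for x
    proof -
      have "(\<lambda>j. s (corner (k - int j) x)) \<longlonglongrightarrow> s x"
        using s(1) by (intro continuous_on_tendsto_compose[OF s(1) corner_tendsto]) auto
      then show ?thesis unfolding F_def G_def by (intro tendsto_intros)
    qed
    have Gm: "G \<in> borel_measurable lebesgue"
      by (rule borel_measurable_LIMSEQ_real[OF conv Fm])
    have w: "integrable lebesgue w"
      using avg_dcube_linear(1)[OF set_integrable_abs[OF bmo(1)[unfolded Qkm]], of "exp M + 1 + M * exp M" "exp M"]
      by (simp add: w_def Qkm set_integrable_def)
    have dom: "norm (F j x) \<le> w x" for j x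
      using abs_exp_tangent_le[OF s(3) s(2), of "corner (k - int j) x" "\<phi> x"]
      by (auto simp: F_def w_def indicator_def algebra_simps)
    have "(\<lambda>j. integral\<^sup>L lebesgue (F j)) \<longlonglongrightarrow> integral\<^sup>L lebesgue G"
      by (rule integral_dominated_convergence[OF Gm Fm w]) (intro AE_I2 conv dom)+
    then have "integral\<^sup>L lebesgue G \<le> K"
      using step[of s] by (intro LIMSEQ_le_const2) (auto simp: F_def set_lebesgue_integral_def)
    then show "(LINT x:Q|lebesgue. exp (s x) * (1 + \<phi> x - s x)) \<le> K"
      by (simp add: G_def set_lebesgue_integral_def)
  qed
  then have "nn_avg Q (\<lambda>x. ennreal (exp (\<phi> x))) \<le> ennreal K / ennreal P"
    unfolding nn_avg_def P(2) by (rule divide_right_mono_ennreal)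
  also have "\<dots> = ennreal (psi (W\<^sup>2) / psi (W\<^sup>2 + \<epsilon>\<^sup>2) * exp (avg Q \<phi>))"
    using P psi0 W(2) psi_nonneg[of "W\<^sup>2"] zero_le_power2[of \<epsilon>] by (simp add: K_def divide_ennreal)
  finally show ?thesis .
qed

section \<open>The lower bound\<close>

definition corner_cube :: "nat \<Rightarrow> (real ^ 'n) set" where
  "corner_cube j = dcube (- int j) 0"

definition shell :: "nat \<Rightarrow> (real ^ 'n) set" where
  "shell j = corner_cube j - corner_cube (Suc j)"

text \<open>Outside the unit cube the index is 0, as on the outermost shell, so
  \<open>extremal\<close> must single out the outside. Inside, positive coordinates guarantee that
  the minimum exists.\<close>

definition shell_index :: "real ^ 'n \<Rightarrow> nat" where
  "shell_index x = (LEAST j. x \<notin> corner_cube (Suc j))"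

lemma mem_corner_cube: "x \<in> corner_cube j \<longleftrightarrow> (\<forall>i. 0 < x $ i \<and> x $ i < (1 / 2) ^ j)"
  by (simp add: corner_cube_def mem_dcube power_int_minus power_one_over field_simps)

lemma sets_corner_cube [measurable, simp]: "corner_cube j \<in> sets lebesgue"
  by (simp add: corner_cube_def)

lemma sets_shell [measurable, simp]: "shell j \<in> sets lebesgue"
  by (simp add: shell_def)

lemma corner_cube_antimono:
  assumes "i \<le> j"
  shows "corner_cube j \<subseteq> corner_cube i"
proof
  fix x :: "real ^ 'n" assume x: "x \<in> corner_cube j"
  have "(1 / 2 :: real) ^ j \<le> (1 / 2) ^ i" using assms by (intro power_decreasing) auto
  then show "x \<in> corner_cube i" using x unfolding mem_corner_cube by (blast intro: less_le_trans)
qed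

lemma shell_index_eq:
  assumes "x \<in> shell j"
  shows "shell_index x = j"
  unfolding shell_index_def
proof (rule Least_equality)
  show "x \<notin> corner_cube (Suc j)" using assms by (simp add: shell_def)
  fix i assume "x \<notin> corner_cube (Suc i)"
  then show "j \<le> i" using assms corner_cube_antimono[of "Suc i" j] by (force simp: shell_def not_le Suc_le_eq)
qed

lemma corner_cube_imp_shell:
  assumes "x \<in> corner_cube j"
  shows "\<exists>i. x \<in> shell (j + i)"
proof (rule ccontr)
  assume *: "\<not> (\<exists>i. x \<in> shell (j + i))"
  have all: "x \<in> corner_cube (j + i)" for i
  proof (induction i)
    case (Suc i)
    then show ?case using * by (auto simp: shell_def)
  qed (use assms in simp)

  have "0 < x $ k" using assms by (simp add: mem_corner_cube)
  then obtain i where "(1 / 2) ^ i < x $ k" using real_arch_pow_inv[of "x $ k" "1/2"] by auto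
  moreover have "(1 / 2 :: real) ^ (j + i) \<le> (1 / 2) ^ i" by (intro power_decreasing) auto
  moreover have "x $ k < (1 / 2) ^ (j + i)" using all[of i] by (simp add: mem_corner_cube)
  ultimately show False by linarith
qed

lemma emeasure_corner_cube:
  "emeasure lebesgue (corner_cube j :: (real ^ 'n) set) = ennreal ((1 / real CARD('n set)) ^ j)"
proof -
  have "((2::real) powi - int j) ^ CARD('n) = (1 / real CARD('n set)) ^ j"
    by (simp add: card_UNIV_set power_int_minus power_one_over mult.commute flip: power_mult power_inverse)
  then show ?thesis by (simp add: corner_cube_def emeasure_dcube)
qed

lemma card_set_ge_2: "2 \<le> real CARD('n::finite set)"
proof -
  have "(2::real) ^ 1 \<le> 2 ^ CARD('n)" by (intro power_increasing) (auto simp: Suc_le_eq)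
  then show ?thesis by (simp add: card_UNIV_set)
qed

lemma emeasure_shell:
  fixes j :: nat
  defines "\<alpha> \<equiv> 1 / real CARD('n::finite set)"
  shows "emeasure lebesgue (shell j :: (real ^ 'n) set) = ennreal ((1 - \<alpha>) * \<alpha> ^ j)"
proof -
  have "emeasure lebesgue (shell j :: (real ^ 'n) set)
      = emeasure lebesgue (corner_cube j :: (real ^ 'n) set) - emeasure lebesgue (corner_cube (Suc j) :: (real ^ 'n) set)"
    unfolding shell_def by (rule emeasure_Diff) (auto simp: emeasure_corner_cube corner_cube_antimono)
  also have "\<dots> = ennreal (\<alpha> ^ j - \<alpha> ^ Suc j)"
    by (simp add: emeasure_corner_cube \<alpha>_def ennreal_minus)
  finally show ?thesis by (simp add: algebra_simps)
qed

text \<open>The sum over disjoint shells yields measurability of the composition and its integral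
  over corner cubes at once.\<close>

lemma shell_index_indicator:
  fixes g :: "nat \<Rightarrow> ennreal"
  shows "g (shell_index x) * indicator (corner_cube j) x = (\<Sum>i. g (j + i) * indicator (shell (j + i)) x)"
proof (cases "x \<in> corner_cube j")
  case True
  then obtain i where i: "x \<in> shell (j + i)" using corner_cube_imp_shell by blast
  have "(\<Sum>i. g (j + i) * indicator (shell (j + i)) x) = (\<Sum>i\<in>{i}. g (j + i) * indicator (shell (j + i)) x)"
    using shell_index_eq[OF i] by (intro suminf_finite) (auto simp: indicator_def dest: shell_index_eq)
  then show ?thesis using True i shell_index_eq[OF i] by simp
next
  case False
  then have "x \<notin> shell (j + i)" for i
    using corner_cube_antimono[of j "j + i"] by (auto simp: shell_def)
  then show ?thesis using False by simp
qed

lemma set_nn_integral_shell_index: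
  fixes g :: "nat \<Rightarrow> ennreal" and j :: nat
  defines "\<alpha> \<equiv> 1 / real CARD('n::finite set)"
  shows "set_nn_integral lebesgue (corner_cube j :: (real ^ 'n) set) (\<lambda>x. g (shell_index x))
    = (\<Sum>i. g (j + i) * ennreal ((1 - \<alpha>) * \<alpha> ^ (j + i)))"
  unfolding shell_index_indicator
  by (subst nn_integral_suminf) (auto simp: nn_integral_cmult_indicator emeasure_shell \<alpha>_def)

lemma has_bochner_integral_shell_index:
  fixes g :: "nat \<Rightarrow> real" and j :: nat
  defines "\<alpha> \<equiv> 1 / real CARD('n::finite set)"
  assumes g: "\<And>i. 0 \<le> g i" and S: "(\<lambda>i. (1 - \<alpha>) * \<alpha> ^ i * g (j + i)) sums S"
  shows "has_bochner_integral lebesgue (\<lambda>x :: real ^ 'n. indicator (corner_cube j) x * g (shell_index x)) (\<alpha> ^ j * S)"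
proof -
  have \<alpha>: "0 < \<alpha>" "\<alpha> < 1" using card_set_ge_2[where 'n = 'n] by (auto simp: \<alpha>_def)
  have nn: "0 \<le> (1 - \<alpha>) * \<alpha> ^ i * g (j + i)" for i using \<alpha> g by simp
  have eq: "ennreal (indicator (corner_cube j) x * g (shell_index x))
      = ennreal (g (shell_index x)) * indicator (corner_cube j) x" for x :: "real ^ 'n"
    by (simp add: indicator_def)
  have "(\<lambda>x :: real ^ 'n. ennreal (g (shell_index x)) * indicator (corner_cube j) x) \<in> borel_measurable lebesgue"
    unfolding shell_index_indicator[of "\<lambda>i. ennreal (g i)"] by measurable
  then have "(\<lambda>x :: real ^ 'n. enn2real (ennreal (indicator (corner_cube j) x * g (shell_index x)))) \<in> borel_measurable lebesgue"
    unfolding eq by measurable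
  then have meas: "(\<lambda>x :: real ^ 'n. indicator (corner_cube j) x * g (shell_index x)) \<in> borel_measurable lebesgue"
    using g by (simp add: enn2real_ennreal)
  have "(\<integral>\<^sup>+x. ennreal (indicator (corner_cube j) x * g (shell_index x)) \<partial>(lebesgue :: (real ^ 'n) measure))
      = (\<Sum>i. ennreal (g (j + i)) * ennreal ((1 - \<alpha>) * \<alpha> ^ (j + i)))"
    unfolding eq \<alpha>_def by (rule set_nn_integral_shell_index)
  also have "\<dots> = (\<Sum>i. ennreal (\<alpha> ^ j * ((1 - \<alpha>) * \<alpha> ^ i * g (j + i))))"
    using \<alpha> g by (intro suminf_cong) (simp add: power_add mult_ac flip: ennreal_mult)
  also have "\<dots> = ennreal (\<alpha> ^ j * S)"
    using \<alpha> nn sums_mult[OF S, of "\<alpha> ^ j"] by (intro suminf_ennreal_eq) auto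
  finally have int: "(\<integral>\<^sup>+x. ennreal (indicator (corner_cube j) x * g (shell_index x)) \<partial>(lebesgue :: (real ^ 'n) measure)) = ennreal (\<alpha> ^ j * S)" .
  have "0 \<le> S" using sums_le[OF nn sums_zero S] by simp
  then show ?thesis
    using \<alpha> g by (intro has_bochner_integral_nn_integral meas int) auto
qed

text \<open>The moments of the geometric distribution come from the telescoping identities
  \<open>(1 - r) * (i - \<mu>) = p i - r * p (i + 1)\<close> with \<open>p i = i\<close> and
  \<open>(1 - r) * (i - \<mu>)\<^sup>2 = p i - r * p (i + 1)\<close> with \<open>p i = i\<^sup>2 + \<mu>\<^sup>2 + \<mu>\<close>.\<close>

lemma telescoping_geometric_sums:
  fixes r :: real and p :: "nat \<Rightarrow> real"
  assumes "(\<lambda>n. r ^ n * p n) \<longlonglongrightarrow> 0"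
  shows "(\<lambda>i. r ^ i * (p i - r * p (Suc i))) sums p 0"
proof -
  have "(\<lambda>n. r ^ n * p n - r ^ Suc n * p (Suc n)) sums (r ^ 0 * p 0 - 0)"
    by (rule telescope_sums'[OF assms])
  then show ?thesis by (simp add: algebra_simps)
qed

lemma geometric_mean_sums:
  fixes r c :: real
  assumes "0 < r" "r < 1"
  shows "(\<lambda>i. (1 - r) * r ^ i * (c + real i)) sums (c + r / (1 - r))"
proof -
  have "(\<lambda>n. real n * r ^ n) \<longlonglongrightarrow> 0" using assms by (intro powser_times_n_limit_0) auto
  then have "(\<lambda>i. r ^ i * (real i - r * real (Suc i))) sums real 0"
    by (intro telescoping_geometric_sums) (simp add: mult.commute)
  moreover have "(\<lambda>i. (c + r / (1 - r)) * (1 - r) * r ^ i) sums ((c + r / (1 - r)) * (1 - r) * (1 / (1 - r)))"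
    using assms by (intro sums_mult geometric_sums) auto
  ultimately have "(\<lambda>i. r ^ i * (real i - r * real (Suc i)) + (c + r / (1 - r)) * (1 - r) * r ^ i)
      sums (real 0 + (c + r / (1 - r)) * (1 - r) * (1 / (1 - r)))"
    by (rule sums_add)
  moreover have "r ^ i * (real i - r * real (Suc i)) + (c + r / (1 - r)) * (1 - r) * r ^ i
      = (1 - r) * r ^ i * (c + real i)" for i
    using assms by (simp add: field_simps)
  ultimately show ?thesis using assms by simp
qed

lemma geometric_variance_sums:
  fixes r :: real
  assumes "0 < r" "r < 1"
  shows "(\<lambda>i. (1 - r) * r ^ i * (real i - r / (1 - r))\<^sup>2) sums (r / (1 - r)\<^sup>2)"
proof -
  define \<mu> where "\<mu> = r / (1 - r)"
  have \<mu>: "(1 - r) * \<mu> = r" using assms by (simp add: \<mu>_def)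
  \<comment> \<open>Squaring this limit gives the one for \<open>n\<^sup>2 * r ^ n\<close>.\<close>
  have "(\<lambda>n. real n * sqrt r ^ n) \<longlonglongrightarrow> 0" using assms by (intro powser_times_n_limit_0) auto
  then have lim: "(\<lambda>n. (real n * sqrt r ^ n)\<^sup>2 + (\<mu>\<^sup>2 + \<mu>) * r ^ n) \<longlonglongrightarrow> 0\<^sup>2 + (\<mu>\<^sup>2 + \<mu>) * 0"
    using assms by (intro tendsto_intros LIMSEQ_power_zero) auto
  have sq: "(real n * sqrt r ^ n)\<^sup>2 = r ^ n * (real n)\<^sup>2" for n
  proof -
    have "(sqrt r ^ n)\<^sup>2 = ((sqrt r)\<^sup>2) ^ n" by (simp only: power_mult[symmetric] mult.commute)
    then show ?thesis using assms by (simp add: power_mult_distrib)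
  qed
  have "(\<lambda>n. r ^ n * ((real n)\<^sup>2 + \<mu>\<^sup>2 + \<mu>)) \<longlonglongrightarrow> 0"
    using lim unfolding sq by (simp add: algebra_simps)
  from telescoping_geometric_sums[OF this]
  have "(\<lambda>i. r ^ i * ((real i)\<^sup>2 + \<mu>\<^sup>2 + \<mu> - r * ((real (Suc i))\<^sup>2 + \<mu>\<^sup>2 + \<mu>))) sums (\<mu>\<^sup>2 + \<mu>)"
    by simp
  moreover have "(real i)\<^sup>2 + \<mu>\<^sup>2 + \<mu> - r * ((real (Suc i))\<^sup>2 + \<mu>\<^sup>2 + \<mu>) = (1 - r) * (real i - \<mu>)\<^sup>2" for i
  proof -
    have "(real i)\<^sup>2 + \<mu>\<^sup>2 + \<mu> - r * ((real (Suc i))\<^sup>2 + \<mu>\<^sup>2 + \<mu>) - (1 - r) * (real i - \<mu>)\<^sup>2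
        = (2 * real i + 1) * ((1 - r) * \<mu> - r)"
      by (simp add: algebra_simps power2_eq_square)
    then show ?thesis using \<mu> by simp
  qed
  moreover have "\<mu>\<^sup>2 + \<mu> = r / (1 - r)\<^sup>2"
  proof -
    have "(1 - r)\<^sup>2 * (\<mu>\<^sup>2 + \<mu>) = ((1 - r) * \<mu>)\<^sup>2 + (1 - r) * ((1 - r) * \<mu>)"
      by (simp add: algebra_simps power2_eq_square)
    also have "\<dots> = r" unfolding \<mu> by (simp add: algebra_simps power2_eq_square)
    finally show ?thesis using assms by (simp add: field_simps)
  qed
  ultimately show ?thesis by (simp add: \<mu>_def mult_ac)
qed

section \<open>The extremal function\<close>

text \<open>The criterion does not mention \<open>x\<close>: a dyadic cube with
  \<open>m \<noteq> 0\<close> is contained in \<open>dcube l 0\<close> or disjoint from it. Cubes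
  with \<open>m = 0\<close> sit at the corner themselves and may properly contain
  \<open>dcube l 0\<close>.\<close>

lemma mem_dcube_zero_iff:
  assumes x: "x \<in> dcube k m" and m: "m \<noteq> 0"
  shows "x \<in> dcube l 0 \<longleftrightarrow> k \<le> l \<and> (\<forall>i. 0 \<le> m $ i \<and> m $ i + 1 \<le> 2 ^ nat (l - k))"
proof -
  define c where "c = (2 powi k :: real)"
  have c: "0 < c" by (simp add: c_def)
  have xi: "of_int (m $ i) * c < x $ i" "x $ i < (of_int (m $ i) + 1) * c" for i
    using x by (auto simp: mem_dcube c_def)
  have lk: "(2 powi l :: real) = of_int (2 ^ nat (l - k)) * c" if "k \<le> l"
  proof -
    have "(2 powi l :: real) = 2 powi (l - k) * 2 powi k" by (simp flip: power_int_add)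
    then show ?thesis using that by (simp add: power_int_nonneg_exp c_def)
  qed
  show ?thesis
  proof
    assume "x \<in> dcube l 0"
    then have x0: "0 < x $ i" "x $ i < 2 powi l" for i by (auto simp: mem_dcube)
    have m0: "0 \<le> m $ i" for i
    proof -
      have "0 < (of_int (m $ i) + 1) * c" using x0(1)[of i] xi(2)[of i] by linarith
      then have "0 < real_of_int (m $ i) + 1" using c by (simp add: zero_less_mult_iff)
      then show ?thesis by linarith
    qed
    obtain i where "m $ i \<noteq> 0" using m by (auto simp: vec_eq_iff)
    then have "1 \<le> real_of_int (m $ i)" using m0[of i] by linarith
    then have "1 * c \<le> of_int (m $ i) * c" using c by (intro mult_right_mono) auto
    then have "c < 2 powi l" using xi(1)[of i] x0(2)[of i] by linarith
    then have "(2 powi k :: real) < 2 powi l" by (simp only: c_def)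
    then have kl: "k \<le> l"
      using power_int_increasing[of l k "2::real"] by (cases "k \<le> l") auto
    moreover have "m $ i + 1 \<le> 2 ^ nat (l - k)" for i
    proof -
      have "of_int (m $ i) * c < of_int (2 ^ nat (l - k)) * c"
        using xi(1)[of i] x0(2)[of i] lk[OF kl] by linarith
      then have "real_of_int (m $ i) < of_int (2 ^ nat (l - k))" using c by simp
      then show ?thesis by linarith
    qed
    ultimately show "k \<le> l \<and> (\<forall>i. 0 \<le> m $ i \<and> m $ i + 1 \<le> 2 ^ nat (l - k))" using m0 by blast
  next
    assume R: "k \<le> l \<and> (\<forall>i. 0 \<le> m $ i \<and> m $ i + 1 \<le> 2 ^ nat (l - k))"
    have "0 < x $ i \<and> x $ i < 2 powi l" for i
    proof
      have "0 \<le> of_int (m $ i) * c" using R c by simp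
      then show "0 < x $ i" using xi(1)[of i] by linarith
      have "real_of_int (m $ i + 1) \<le> of_int (2 ^ nat (l - k))" using R by (simp only: of_int_le_iff)
      then have "(of_int (m $ i) + 1) * c \<le> of_int (2 ^ nat (l - k)) * c"
        using c by (intro mult_right_mono) auto
      then show "x $ i < 2 powi l" using xi(2)[of i] R by (simp add: lk)
    qed
    then show "x \<in> dcube l 0" by (simp add: mem_dcube)
  qed
qed

lemma dcube_corner_cube_cong:
  assumes "x \<in> dcube k m" "y \<in> dcube k m" "m \<noteq> 0"
  shows "x \<in> corner_cube j \<longleftrightarrow> y \<in> corner_cube j"
  unfolding corner_cube_def using assms by (simp add: mem_dcube_zero_iff)

text \<open>On the unit cube the shell index is geometrically distributed with mean
  \<open>\<alpha> / (1 - \<alpha>)\<close>, where \<alpha> is the reciprocal number of children; the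
  offset \<open>\<alpha> * D\<close> makes the mean 0. The step \<open>(1 - \<alpha>) * D\<close>
  puts the mean on the corner child at distance \<open>D\<close> from the value on the other
  children, as in the extremal configuration of \<open>gap\<close>.\<close>

definition extremal :: "real \<Rightarrow> real ^ 'n \<Rightarrow> real" where
  "extremal D x = (if x \<in> corner_cube 0
     then (1 - 1 / real CARD('n set)) * D * real (shell_index x) - 1 / real CARD('n set) * D else 0)"

text \<open>Within \<open>corner_cube j\<close> the index minus \<open>j\<close> has the same
  geometric law for every \<open>j\<close>, so the mean moves in equal steps and the variance does
  not change.\<close>

lemma extremal_corner_cube:
  fixes j :: nat and D :: real
  defines "\<alpha> \<equiv> 1 / real CARD('n::finite set)"
  defines "a \<equiv> (1 - \<alpha>) * D * real j"
  defines "U \<equiv> corner_cube j :: (real ^ 'n) set"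
  shows "has_bochner_integral lebesgue (\<lambda>x. indicator U x * extremal D x) (\<alpha> ^ j * a)"
    and "(\<integral>\<^sup>+x. ennreal ((extremal D x - a)\<^sup>2) * indicator U x \<partial>lebesgue) = ennreal (\<alpha> ^ j * (\<alpha> * D\<^sup>2))"
proof -
  have \<alpha>: "0 < \<alpha>" "\<alpha> < 1" using card_set_ge_2[where 'n = 'n] by (auto simp: \<alpha>_def)
  have \<phi>: "extremal D x = (1 - \<alpha>) * D * real (shell_index x) - \<alpha> * D" if "x \<in> U" for x
    using that corner_cube_antimono[of 0 j] by (auto simp: extremal_def U_def \<alpha>_def)
  have "has_bochner_integral lebesgue (\<lambda>x. indicator U x * real (shell_index x)) (\<alpha> ^ j * (real j + \<alpha> / (1 - \<alpha>)))"
    using geometric_mean_sums[OF \<alpha>, of "real j"] unfolding U_def \<alpha>_def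
    by (intro has_bochner_integral_shell_index) simp_all
  moreover have "has_bochner_integral lebesgue (\<lambda>x. indicator U x) (\<alpha> ^ j)"
    unfolding U_def \<alpha>_def
    by (intro has_bochner_integral_nn_integral) (auto simp: emeasure_corner_cube ennreal_indicator)
  ultimately have "has_bochner_integral lebesgue
      (\<lambda>x. (1 - \<alpha>) * D * (indicator U x * real (shell_index x)) - \<alpha> * D * indicator U x)
      ((1 - \<alpha>) * D * (\<alpha> ^ j * (real j + \<alpha> / (1 - \<alpha>))) - \<alpha> * D * \<alpha> ^ j)"
    by (intro has_bochner_integral_diff has_bochner_integral_mult_right)
  moreover have "(\<lambda>x. (1 - \<alpha>) * D * (indicator U x * real (shell_index x)) - \<alpha> * D * indicator U x)
      = (\<lambda>x. indicator U x * extremal D x)"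
    by (auto simp: \<phi> indicator_def)
  moreover have "(1 - \<alpha>) * D * (\<alpha> ^ j * (real j + \<alpha> / (1 - \<alpha>))) - \<alpha> * D * \<alpha> ^ j = \<alpha> ^ j * a"
    using \<alpha> by (simp add: a_def field_simps)
  ultimately show "has_bochner_integral lebesgue (\<lambda>x. indicator U x * extremal D x) (\<alpha> ^ j * a)"
    by simp
  define g where "g = (\<lambda>i::nat. ((1 - \<alpha>) * D * real i - \<alpha> * D - a)\<^sup>2)"
  have "(\<lambda>i. ((1 - \<alpha>) * D)\<^sup>2 * ((1 - \<alpha>) * \<alpha> ^ i * (real i - \<alpha> / (1 - \<alpha>))\<^sup>2)) sums
      (((1 - \<alpha>) * D)\<^sup>2 * (\<alpha> / (1 - \<alpha>)\<^sup>2))"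
    by (intro sums_mult geometric_variance_sums \<alpha>)
  moreover have "((1 - \<alpha>) * D)\<^sup>2 * ((1 - \<alpha>) * \<alpha> ^ i * (real i - \<alpha> / (1 - \<alpha>))\<^sup>2) = (1 - \<alpha>) * \<alpha> ^ i * g (j + i)" for i
  proof -
    have "(1 - \<alpha>) * D * (real i - \<alpha> / (1 - \<alpha>)) = (1 - \<alpha>) * D * real (j + i) - \<alpha> * D - a"
      using \<alpha> by (simp add: a_def field_simps)
    then have "g (j + i) = ((1 - \<alpha>) * D * (real i - \<alpha> / (1 - \<alpha>)))\<^sup>2" by (simp add: g_def)
    then show ?thesis by (simp add: power_mult_distrib)
  qed
  moreover have "((1 - \<alpha>) * D)\<^sup>2 * (\<alpha> / (1 - \<alpha>)\<^sup>2) = \<alpha> * D\<^sup>2"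
    using \<alpha> by (simp add: power_mult_distrib)
  ultimately have "(\<lambda>i. (1 - \<alpha>) * \<alpha> ^ i * g (j + i)) sums (\<alpha> * D\<^sup>2)" by simp
  then have B: "has_bochner_integral lebesgue (\<lambda>x. indicator U x * g (shell_index x)) (\<alpha> ^ j * (\<alpha> * D\<^sup>2))"
    unfolding U_def \<alpha>_def by (intro has_bochner_integral_shell_index) (simp_all add: g_def)
  have "(\<integral>\<^sup>+x. ennreal ((extremal D x - a)\<^sup>2) * indicator U x \<partial>lebesgue)
      = (\<integral>\<^sup>+x. ennreal (indicator U x * g (shell_index x)) \<partial>lebesgue)"
    by (intro nn_integral_cong) (auto simp: \<phi> g_def indicator_def algebra_simps)
  also have "\<dots> = ennreal (\<alpha> ^ j * (\<alpha> * D\<^sup>2))"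
    using B by (subst nn_integral_eq_integral) (auto simp: has_bochner_integral_iff g_def)
  finally show "(\<integral>\<^sup>+x. ennreal ((extremal D x - a)\<^sup>2) * indicator U x \<partial>lebesgue) = ennreal (\<alpha> ^ j * (\<alpha> * D\<^sup>2))" .
qed

text \<open>Away from the corner 0 the function is constant on each cube. Cubes at the corner inside
  the unit cube have variance exactly \<open>\<epsilon>\<^sup>2\<close>; larger ones have mean 0 and
  spread the same integral over a volume at least 1.\<close>

lemma extremal_in_BMO_ball:
  fixes D \<epsilon> :: real
  assumes \<epsilon>: "0 \<le> \<epsilon>" and D: "1 / real CARD('n::finite set) * D\<^sup>2 = \<epsilon>\<^sup>2"
  shows "(extremal D :: real ^ 'n \<Rightarrow> real) \<in> BMO_ball \<epsilon>"
proof -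
  let ?\<phi> = "extremal D :: real ^ 'n \<Rightarrow> real"
  define \<alpha> where "\<alpha> = 1 / real CARD('n set)"
  have \<alpha>: "0 < \<alpha>" "\<alpha> * D\<^sup>2 = \<epsilon>\<^sup>2" using D card_set_ge_2[where 'n = 'n] by (auto simp: \<alpha>_def)
  have ind0: "indicator (corner_cube 0) x * ?\<phi> x = ?\<phi> x" for x
    by (simp add: extremal_def indicator_def)
  have int0: "has_bochner_integral lebesgue ?\<phi> 0"
    using extremal_corner_cube(1)[where 'n = 'n and j = 0 and D = D] by (simp add: ind0)
  have sq0: "(\<integral>\<^sup>+x. ennreal ((?\<phi> x)\<^sup>2) \<partial>lebesgue) = ennreal (\<epsilon>\<^sup>2)"
  proof -
    have "(\<integral>\<^sup>+x. ennreal ((?\<phi> x)\<^sup>2) \<partial>lebesgue)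
        = (\<integral>\<^sup>+x. ennreal ((?\<phi> x - 0)\<^sup>2) * indicator (corner_cube 0) x \<partial>lebesgue)"
      by (intro nn_integral_cong) (simp add: extremal_def indicator_def)
    then show ?thesis using extremal_corner_cube(2)[where 'n = 'n and j = 0 and D = D] \<alpha>(2) by (simp add: \<alpha>_def)
  qed
  have loc: "locally_integrable ?\<phi>"
    unfolding locally_integrable_def set_integrable_def
  proof (intro allI impI integrable_mult_indicator)
    show "K \<in> sets lebesgue" if "compact K" for K :: "(real ^ 'n) set"
      using that by (simp add: lmeasurable_compact fmeasurableD)
    show "integrable lebesgue ?\<phi>" using int0 by (simp add: has_bochner_integral_iff)
  qed
  have "nn_avg J (\<lambda>x. ennreal (\<bar>?\<phi> x - avg J ?\<phi>\<bar>\<^sup>2)) \<le> ennreal (\<epsilon>\<^sup>2)"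
    if J: "J \<in> dyadic_cubes" for J
  proof -
    obtain k m where Jkm: "J = dcube k m" using J by (auto simp: dyadic_cubes_eq)
    define P where "P = measure lebesgue J"
    have P: "0 < P" "emeasure lebesgue J = ennreal P" by (simp_all add: P_def Jkm emeasure_dcube)
    consider "m \<noteq> 0" | "m = 0" "k \<le> 0" | "m = 0" "0 < k" by linarith
    then show ?thesis
    proof cases
      case 1
      have "J \<noteq> {}" using P by auto
      then obtain y where y: "y \<in> J" by blast
      have const: "?\<phi> x = ?\<phi> y" if "x \<in> J" for x
        unfolding extremal_def shell_index_def
        using dcube_corner_cube_cong[of x k m y] that y 1 unfolding Jkm by simp
      have "(LINT x:J|lebesgue. ?\<phi> x) = (LINT x:J|lebesgue. ?\<phi> y)"
        by (intro set_lebesgue_integral_cong) (auto simp: const Jkm)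
      also have "\<dots> = P * ?\<phi> y" by (simp add: set_lebesgue_integral_def P_def Jkm del: measure_dcube)
      finally have "avg J ?\<phi> = ?\<phi> y" using P by (simp add: avg_def P_def)
      then have "nn_avg J (\<lambda>x. ennreal (\<bar>?\<phi> x - avg J ?\<phi>\<bar>\<^sup>2)) = 0"
        unfolding nn_avg_def
        by (subst nn_integral_cong[of _ _ "\<lambda>_. 0"]) (auto simp: const indicator_def)
      then show ?thesis by simp
    next
      case 2
      define j where "j = nat (- k)"
      have Jj: "J = corner_cube j" using 2 by (simp add: Jkm corner_cube_def j_def)
      have PJ: "P = \<alpha> ^ j"
        using P(2) \<alpha> less_imp_le[OF P(1)] unfolding Jj by (simp add: emeasure_corner_cube \<alpha>_def)
      note ex = extremal_corner_cube[where 'n = 'n and j = j and D = D, folded \<alpha>_def Jj]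
      have "avg J ?\<phi> = (1 - \<alpha>) * D * real j"
        using ex(1) P(1) \<alpha>(1) by (simp add: avg_def P_def[symmetric] PJ set_lebesgue_integral_def has_bochner_integral_iff)
      then have "nn_avg J (\<lambda>x. ennreal (\<bar>?\<phi> x - avg J ?\<phi>\<bar>\<^sup>2)) = ennreal (\<alpha> ^ j * (\<alpha> * D\<^sup>2)) / ennreal (\<alpha> ^ j)"
        using ex(2) by (simp add: nn_avg_def P(2) PJ)
      also have "\<dots> = ennreal (\<alpha> * D\<^sup>2)" using \<alpha> by (simp add: divide_ennreal)
      finally show ?thesis by (simp add: \<alpha>)
    next
      case 3
      have sub: "corner_cube 0 \<subseteq> J"
      proof
        fix x :: "real ^ 'n" assume "x \<in> corner_cube 0"
        moreover have "(1::real) \<le> 2 powi k" using 3 power_int_increasing[of 0 k "2::real"] by simp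
        ultimately show "x \<in> J" using 3 by (auto simp: mem_corner_cube Jkm mem_dcube intro: less_le_trans)
      qed
      have "(\<lambda>x. indicator J x * ?\<phi> x) = ?\<phi>"
      proof
        fix x show "indicator J x * ?\<phi> x = ?\<phi> x"
          using sub by (auto simp: extremal_def indicator_def)
      qed
      then have "avg J ?\<phi> = 0"
        using int0 by (simp add: avg_def set_lebesgue_integral_def has_bochner_integral_iff)
      moreover have "(\<integral>\<^sup>+x. ennreal ((?\<phi> x)\<^sup>2) * indicator J x \<partial>lebesgue) \<le> (\<integral>\<^sup>+x. ennreal ((?\<phi> x)\<^sup>2) \<partial>lebesgue)"
        by (intro nn_integral_mono) (simp add: indicator_def)
      ultimately have "nn_avg J (\<lambda>x. ennreal (\<bar>?\<phi> x - avg J ?\<phi>\<bar>\<^sup>2)) \<le> ennreal (\<epsilon>\<^sup>2) / ennreal P"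
        unfolding nn_avg_def P(2) sq0 by (simp add: divide_right_mono_ennreal)
      also have "\<dots> = ennreal (\<epsilon>\<^sup>2 / P)" using P by (simp add: divide_ennreal)
      also have "\<dots> \<le> ennreal (\<epsilon>\<^sup>2)"
      proof -
        have "(1::real) \<le> 2 powi k" using 3 power_int_increasing[of 0 k "2::real"] by simp
        then have "1 \<le> P" unfolding P_def Jkm measure_dcube by (rule one_le_power)
        then have "\<epsilon>\<^sup>2 / P \<le> \<epsilon>\<^sup>2 / 1" by (intro divide_left_mono) auto
        then show ?thesis by (intro ennreal_leI) simp
      qed
      finally show ?thesis .
    qed
  qed
  then have "bmo_norm ?\<phi> \<le> ennreal \<epsilon>"
    unfolding bmo_norm_def using \<epsilon> by (intro SUP_least) (simp add: ennreal_sqrt_le_iff)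
  moreover from this have "bmo_norm ?\<phi> < \<infinity>" by (simp add: le_less_trans)
  ultimately show ?thesis using loc by (simp add: BMO_ball_def BMO_def)
qed

text \<open>The exponential of \<open>extremal D\<close> integrates over the unit cube to a
  geometric series: a finite \<open>C\<close> forces its ratio below 1, and its sum bounds
  \<open>C\<close> from below.\<close>

lemma JN_constant_lower:
  fixes \<epsilon> C :: real
  defines "\<alpha> \<equiv> 1 / real CARD('n::finite set)"
  defines "D \<equiv> \<epsilon> / sqrt \<alpha>"
  assumes \<epsilon>: "0 \<le> \<epsilon>" and C: "JN_constant TYPE('n) \<epsilon> C"
  shows "\<alpha> * exp ((1 - \<alpha>) * D) < 1"
    and "(1 - \<alpha>) * exp (- (\<alpha> * D)) / (1 - \<alpha> * exp ((1 - \<alpha>) * D)) \<le> C"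
proof -
  let ?\<phi> = "extremal D :: real ^ 'n \<Rightarrow> real"
  let ?Q = "corner_cube 0 :: (real ^ 'n) set"
  have \<alpha>: "0 < \<alpha>" "\<alpha> < 1" using card_set_ge_2[where 'n = 'n] by (auto simp: \<alpha>_def)
  have "\<alpha> * D\<^sup>2 = \<epsilon>\<^sup>2" using \<alpha> by (simp add: D_def power_divide)
  then have \<phi>: "?\<phi> \<in> BMO_ball \<epsilon>" using \<epsilon> by (intro extremal_in_BMO_ball) (simp_all add: \<alpha>_def)
  have Q: "?Q \<in> dyadic_cubes" by (simp add: corner_cube_def)
  have em: "emeasure lebesgue ?Q = 1" by (simp add: emeasure_corner_cube)
  have avg0: "avg ?Q ?\<phi> = 0"
    using extremal_corner_cube(1)[where 'n = 'n and j = 0 and D = D]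
    by (simp add: avg_def set_lebesgue_integral_def has_bochner_integral_iff)
  define \<rho> where "\<rho> = \<alpha> * exp ((1 - \<alpha>) * D)"
  define c where "c = (1 - \<alpha>) * exp (- (\<alpha> * D))"
  have \<rho>: "0 < \<rho>" and c: "0 < c" using \<alpha> by (simp_all add: \<rho>_def c_def)
  define g where "g = (\<lambda>i::nat. ennreal (exp ((1 - \<alpha>) * D * real i - \<alpha> * D)))"
  have g: "g i * ennreal ((1 - \<alpha>) * \<alpha> ^ i) = ennreal (c * \<rho> ^ i)" for i
    using \<alpha> by (simp add: g_def c_def \<rho>_def power_mult_distrib exp_diff exp_minus divide_inverse
        mult_ac flip: ennreal_mult exp_of_nat_mult)
  have "(\<Sum>i. ennreal (c * \<rho> ^ i)) = set_nn_integral lebesgue ?Q (\<lambda>x. g (shell_index x))"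
    using set_nn_integral_shell_index[where 'n = 'n and j = 0 and g = g, folded \<alpha>_def] by (simp add: g)
  also have "\<dots> = nn_avg ?Q (\<lambda>x. ennreal (exp (?\<phi> x)))"
  proof -
    have "set_nn_integral lebesgue ?Q (\<lambda>x. g (shell_index x)) = set_nn_integral lebesgue ?Q (\<lambda>x. ennreal (exp (?\<phi> x)))"
      by (intro nn_integral_cong) (simp add: g_def extremal_def \<alpha>_def indicator_def)
    then show ?thesis by (simp add: nn_avg_def em divide_ennreal_def)
  qed
  also have "\<dots> \<le> ennreal C"
    using C \<phi> Q avg0 unfolding JN_constant_def by fastforce
  finally have sum: "(\<Sum>i. ennreal (c * \<rho> ^ i)) \<le> ennreal C" .
  have C0: "0 < C" using C by (simp add: JN_constant_def)
  \<comment> \<open>Partial sums are bounded before convergence is known, so that the same bound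
    also excludes a ratio of at least 1.\<close>
  have partial: "(\<Sum>i<n. c * \<rho> ^ i) \<le> C" for n
  proof -
    have "ennreal (\<Sum>i<n. c * \<rho> ^ i) = (\<Sum>i<n. ennreal (c * \<rho> ^ i))"
      using c \<rho> by (simp add: sum_ennreal)
    also have "\<dots> \<le> (\<Sum>i. ennreal (c * \<rho> ^ i))" by (intro sum_le_suminf) auto
    also note sum
    finally show ?thesis using C0 by (simp add: ennreal_le_iff)
  qed
  have \<rho>1: "\<rho> < 1"
  proof (rule ccontr)
    assume "\<not> \<rho> < 1"
    then have "c * 1 \<le> c * \<rho> ^ i" for i using c by (intro mult_left_mono one_le_power) auto
    then have "(\<Sum>i<n. c) \<le> (\<Sum>i<n. c * \<rho> ^ i)" for n :: nat by (intro sum_mono) simp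
    then have "(\<Sum>i<n. c) \<le> C" for n :: nat using partial[of n] by (rule order_trans)
    then have "real n * c \<le> C" for n by simp
    moreover obtain n where "C < real n * c" using reals_Archimedean3[OF c] by blast
    ultimately show False by (simp add: not_le[symmetric])
  qed
  then show "\<alpha> * exp ((1 - \<alpha>) * D) < 1" by (simp add: \<rho>_def)
  have "(\<lambda>i. c * \<rho> ^ i) sums (c * (1 / (1 - \<rho>)))"
    using \<rho> \<rho>1 by (intro sums_mult geometric_sums) auto
  then have "c * (1 / (1 - \<rho>)) \<le> C"
    unfolding sums_def using partial by (intro LIMSEQ_le_const2) auto
  then show "(1 - \<alpha>) * exp (- (\<alpha> * D)) / (1 - \<alpha> * exp ((1 - \<alpha>) * D)) \<le> C"
    by (simp add: c_def \<rho>_def)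
qed

section \<open>The sharp constants\<close>

text \<open>Solving the vanishing gap for the quotient of \<open>psi\<close> values identifies the
  Bellman bound with the geometric sum in \<open>JN_constant_lower\<close>.\<close>

lemma JN_constant_upper:
  fixes \<epsilon> :: real
  defines "\<alpha> \<equiv> 1 / real CARD('n::finite set)"
  defines "D \<equiv> \<epsilon> / sqrt \<alpha>"
  assumes \<epsilon>: "0 \<le> \<epsilon>" and sub: "\<alpha> * exp ((1 - \<alpha>) * D) < 1"
  shows "JN_constant TYPE('n) \<epsilon> ((1 - \<alpha>) * exp (- (\<alpha> * D)) / (1 - \<alpha> * exp ((1 - \<alpha>) * D)))"
proof -
  have \<alpha>: "0 < \<alpha>" "\<alpha> < 1" using card_set_ge_2[where 'n = 'n] by (auto simp: \<alpha>_def)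
  obtain W where W: "0 \<le> W" "W\<^sup>2 + \<epsilon>\<^sup>2 < 1" and gap: "gap \<alpha> (W\<^sup>2 + \<epsilon>\<^sup>2) (W\<^sup>2) (W\<^sup>2) D = 0"
    using exists_radius[OF \<alpha> \<epsilon>] sub unfolding D_def by blast
  have "0 < psi (W\<^sup>2 + \<epsilon>\<^sup>2)" by (rule psi_pos[OF W(2)])
  moreover have "psi (W\<^sup>2) * (1 - \<alpha> * exp ((1 - \<alpha>) * D)) = (1 - \<alpha>) * exp (- (\<alpha> * D)) * psi (W\<^sup>2 + \<epsilon>\<^sup>2)"
    using gap unfolding gap_def by (simp add: right_diff_distrib mult_ac)
  ultimately have eq: "psi (W\<^sup>2) / psi (W\<^sup>2 + \<epsilon>\<^sup>2) = (1 - \<alpha>) * exp (- (\<alpha> * D)) / (1 - \<alpha> * exp ((1 - \<alpha>) * D))"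
    using sub by (simp add: frac_eq_eq)
  have "0 \<le> gap (1 / real CARD('n set)) (W\<^sup>2 + \<epsilon>\<^sup>2) (W\<^sup>2) (W\<^sup>2) (\<epsilon> / sqrt (1 / real CARD('n set)))"
    using gap unfolding D_def \<alpha>_def by simp
  then have "nn_avg Q (\<lambda>x. ennreal (exp (\<phi> x))) \<le> ennreal (psi (W\<^sup>2) / psi (W\<^sup>2 + \<epsilon>\<^sup>2) * exp (avg Q \<phi>))"
    if "\<phi> \<in> BMO_ball \<epsilon>" "Q \<in> dyadic_cubes" for \<phi> :: "real ^ 'n \<Rightarrow> real" and Q
    using exp_integral_bound[OF that(1) \<epsilon> W _ that(2)] by blast
  then show ?thesis
    using \<alpha> sub unfolding JN_constant_def eq by auto
qed

lemma subcritical_iff: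
  fixes \<epsilon> :: real
  defines "\<alpha> \<equiv> 1 / real CARD('n::finite set)"
  shows "\<alpha> * exp ((1 - \<alpha>) * (\<epsilon> / sqrt \<alpha>)) < 1 \<longleftrightarrow>
    \<epsilon> < 2 powr (real CARD('n) / 2) / (2 ^ CARD('n) - 1) * real CARD('n) * ln 2"
proof -
  define N where "N = (2::real) ^ CARD('n)"
  have N: "1 < N" and \<alpha>: "\<alpha> = 1 / N"
    by (simp_all add: N_def \<alpha>_def card_UNIV_set one_less_power)
  have sqrtN: "sqrt N = 2 powr (real CARD('n) / 2)"
    by (simp add: N_def powr_half_sqrt[symmetric] powr_powr flip: powr_realpow)
  have lnN: "ln N = real CARD('n) * ln 2" by (simp add: N_def ln_realpow)
  have "(1 - \<alpha>) * (\<epsilon> / sqrt \<alpha>) = (N - 1) / sqrt N * \<epsilon>"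
    using N by (simp add: \<alpha> real_sqrt_divide field_simps)
  then have "\<alpha> * exp ((1 - \<alpha>) * (\<epsilon> / sqrt \<alpha>)) < 1 \<longleftrightarrow> exp ((N - 1) / sqrt N * \<epsilon>) < exp (ln N)"
    using N by (simp add: \<alpha>)
  also have "\<dots> \<longleftrightarrow> \<epsilon> < sqrt N / (N - 1) * ln N"
    unfolding exp_less_cancel_iff using N by (simp add: field_simps)
  finally show ?thesis unfolding sqrtN lnN by (simp add: N_def mult.assoc)
qed

lemma constant_eq:
  fixes \<epsilon> :: real
  defines "\<alpha> \<equiv> 1 / real CARD('n::finite set)"
  defines "D \<equiv> \<epsilon> / sqrt \<alpha>"
  shows "(1 - \<alpha>) * exp (- (\<alpha> * D)) / (1 - \<alpha> * exp ((1 - \<alpha>) * D)) =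
    (2 ^ CARD('n) - 1) / (2 ^ CARD('n) * exp (2 powr (- real CARD('n) / 2) * \<epsilon>)
      - exp (2 powr (real CARD('n) / 2) * \<epsilon>))"
proof -
  define N where "N = (2::real) ^ CARD('n)"
  have N: "1 < N" and \<alpha>: "\<alpha> = 1 / N"
    by (simp_all add: N_def \<alpha>_def card_UNIV_set one_less_power)
  have sqrtN: "sqrt N = 2 powr (real CARD('n) / 2)"
    by (simp add: N_def powr_half_sqrt[symmetric] powr_powr flip: powr_realpow)
  have D: "D = 2 powr (real CARD('n) / 2) * \<epsilon>"
    using N by (simp add: D_def \<alpha> real_sqrt_divide mult.commute flip: sqrtN)
  have \<alpha>D: "\<alpha> * D = 2 powr (- real CARD('n) / 2) * \<epsilon>"
  proof -
    have "\<alpha> * D = 1 / N * sqrt N * \<epsilon>" unfolding \<alpha> D sqrtN by simp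
    also have "1 / N * sqrt N = inverse (sqrt N)"
      using N by (simp add: divide_inverse[symmetric] field_simps)
    also have "\<dots> = 2 powr (- real CARD('n) / 2)" unfolding sqrtN by (simp add: powr_minus[symmetric])
    finally show ?thesis .
  qed
  \<comment> \<open>Expanding the fraction by \<open>N * exp (\<alpha> * D)\<close> clears the inner
    quotients.\<close>
  have "(1 - \<alpha>) * exp (- (\<alpha> * D)) / (1 - \<alpha> * exp ((1 - \<alpha>) * D))
      = (N * exp (\<alpha> * D) * ((1 - \<alpha>) * exp (- (\<alpha> * D)))) / (N * exp (\<alpha> * D) * (1 - \<alpha> * exp ((1 - \<alpha>) * D)))"
    using N by (intro mult_divide_mult_cancel_left[symmetric]) simp
  also have "N * exp (\<alpha> * D) * ((1 - \<alpha>) * exp (- (\<alpha> * D))) = N - 1"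
    using N by (simp add: \<alpha> exp_minus field_simps)
  also have "N * exp (\<alpha> * D) * (1 - \<alpha> * exp ((1 - \<alpha>) * D)) = N * exp (\<alpha> * D) - exp D"
  proof -
    have "exp (\<alpha> * D) * exp ((1 - \<alpha>) * D) = exp D" by (simp add: left_diff_distrib flip: exp_add)
    moreover have "N * exp (\<alpha> * D) * (1 - \<alpha> * exp ((1 - \<alpha>) * D))
        = N * exp (\<alpha> * D) - N * \<alpha> * (exp (\<alpha> * D) * exp ((1 - \<alpha>) * D))"
      by (simp add: right_diff_distrib mult_ac)
    ultimately show ?thesis using N by (simp add: \<alpha>)
  qed
  finally show ?thesis unfolding \<alpha>D N_def D[symmetric] .
qed

theorem theorem1p3:
  shows "JN_range TYPE('n::finite) (sharp_eps0 TYPE('n)) \<and>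
    (\<forall>\<epsilon>0. JN_range TYPE('n) \<epsilon>0 \<longrightarrow> \<epsilon>0 \<le> sharp_eps0 TYPE('n)) \<and>
    sharp_eps0 TYPE('n) =
      2 powr (real CARD('n) / 2) / (2 ^ CARD('n) - 1) * real CARD('n) * ln 2 \<and>
    (\<forall>\<epsilon>. 0 \<le> \<epsilon> \<and> \<epsilon> < sharp_eps0 TYPE('n) \<longrightarrow>
      JN_constant TYPE('n) \<epsilon> (sharp_C \<epsilon> TYPE('n)) \<and>
      (\<forall>C. JN_constant TYPE('n) \<epsilon> C \<longrightarrow> sharp_C \<epsilon> TYPE('n) \<le> C) \<and>
      sharp_C \<epsilon> TYPE('n) =
        (2 ^ CARD('n) - 1) /
        (2 ^ CARD('n) * exp (2 powr (- real CARD('n) / 2) * \<epsilon>)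
          - exp (2 powr (real CARD('n) / 2) * \<epsilon>)))"
proof -
  define E where "E = 2 powr (real CARD('n) / 2) / (2 ^ CARD('n) - 1) * real CARD('n) * ln 2"
  define c where "c = (\<lambda>\<epsilon>. (2 ^ CARD('n) - 1) /
        (2 ^ CARD('n) * exp (2 powr (- real CARD('n) / 2) * \<epsilon>)
          - exp (2 powr (real CARD('n) / 2) * \<epsilon>)))"
  have upper: "JN_constant TYPE('n) \<epsilon> (c \<epsilon>)" if "0 \<le> \<epsilon>" "\<epsilon> < E" for \<epsilon>
    using JN_constant_upper[where 'n = 'n, of \<epsilon>] that
    unfolding subcritical_iff constant_eq E_def c_def by blast
  have lower: "\<epsilon> < E" "c \<epsilon> \<le> C" if "0 \<le> \<epsilon>" "JN_constant TYPE('n) \<epsilon> C" for \<epsilon> C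
    using JN_constant_lower[where 'n = 'n, of \<epsilon> C] that
    unfolding subcritical_iff constant_eq E_def c_def by blast+
  have "1 < (2::real) ^ CARD('n)" by (rule one_less_power) auto
  then have E: "0 < E" by (simp add: E_def)
  have range: "JN_range TYPE('n) E" using upper E by (auto simp: JN_range_def)
  \<comment> \<open>A larger range would contain \<open>E\<close> itself, but \<open>lower\<close>
    excludes any constant at \<open>E\<close>.\<close>
  have max: "\<epsilon>0 \<le> E" if eps: "JN_range TYPE('n) \<epsilon>0" for \<epsilon>0
  proof (rule ccontr)
    assume "\<not> \<epsilon>0 \<le> E"
    then have "0 \<le> E \<and> E < \<epsilon>0" using E by simp
    then obtain C where "JN_constant TYPE('n) E C" using eps unfolding JN_range_def by blast
    then show False using lower(1)[of E C] E by simp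
  qed
  have eps0: "sharp_eps0 TYPE('n) = E"
    unfolding sharp_eps0_def using range max by (rule Greatest_equality)
  have sharp: "sharp_C \<epsilon> TYPE('n) = c \<epsilon>" if "0 \<le> \<epsilon>" "\<epsilon> < E" for \<epsilon>
    unfolding sharp_C_def using upper[OF that] lower(2)[OF that(1)] by (rule Least_equality)
  show ?thesis
    using range max upper lower(2) sharp unfolding eps0 E_def[symmetric] by (auto simp: c_def)
qed

end
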